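(* Let $T>0$, $a\in\mathbb{R}$, $\sigma>0$ and $H\in(\tfrac12,1)$. Let $B^H=(B^H_t)_{t\in[0,T]}$ be a fractional Brownian motion with Hurst index $H$ and let $$F=\int_0^T e^{as+\sigma B^H_s}\,ds .$$ Let $\rho_F$ denote the density of the law of $F$ (with respect to Lebesgue measure). Then there exists a positive constant $c$ (not depending on $x$) such that $$\rho_F(x)\leq \frac{c}{x}\exp\left(-\frac{(\ln x-E[\ln F])^2}{8\sigma^2T^{2H}}\right)\quad\text{for all } 0<x\leq e^{E[\ln F]}.$$
   Context: A fractional Brownian motion with Hurst index $H\in(0,1)$ on $[0,T]$ is a centered Gaussian process $B^H=(B^H_t)_{t\in[0,T]}$ (with continuous paths) with covariance $E[B^H_tB^H_s]=\frac12\left(t^{2H}+s^{2H}-|t-s|^{2H}\right)$, $0\le s,t\le T$. The existence of the density $\rho_F$ is part of the assertion; as usual, the density is understood up to the choice of a version. *)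

theory Defs
  imports "HOL-Probability.Probability"
begin

(* The law N(mu, sd^2). For sd = 0 this is the point mass at mu; the degenerate case
   is needed because a fractional Brownian motion starts at 0 almost surely. *)
definition normal_law :: "real \<Rightarrow> real \<Rightarrow> real measure" where
  "normal_law \<mu> sd = (if sd = 0 then return borel \<mu> else density lborel (normal_density \<mu> sd))"

definition gaussian_rv :: "'a measure \<Rightarrow> ('a \<Rightarrow> real) \<Rightarrow> bool" where
  "gaussian_rv M X \<longleftrightarrow>
     X \<in> borel_measurable M \<and> (\<exists>\<mu> sd. 0 \<le> sd \<and> distr M borel X = normal_law \<mu> sd)"

definition gaussian_process :: "'a measure \<Rightarrow> 'i set \<Rightarrow> ('i \<Rightarrow> 'a \<Rightarrow> real) \<Rightarrow> bool" where
  "gaussian_process M I X \<longleftrightarrow>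
     prob_space M \<and>
     (\<forall>J c. finite J \<and> J \<subseteq> I \<longrightarrow> gaussian_rv M (\<lambda>\<omega>. \<Sum>t\<in>J. c t * X t \<omega>))"

(* Continuity is required of every path, so that pathwise integrals over [0,T]
   are random variables even when M is not complete. *)
definition fractional_brownian_motion ::
    "'a measure \<Rightarrow> real \<Rightarrow> real \<Rightarrow> (real \<Rightarrow> 'a \<Rightarrow> real) \<Rightarrow> bool" where
  "fractional_brownian_motion M T H B \<longleftrightarrow>
     0 < H \<and> H < 1 \<and>
     gaussian_process M {0..T} B \<and>
     (\<forall>t\<in>{0..T}. (\<integral>\<omega>. B t \<omega> \<partial>M) = 0) \<and>
     (\<forall>s\<in>{0..T}. \<forall>t\<in>{0..T}. (\<integral>\<omega>. B t \<omega> * B s \<omega> \<partial>M) =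
        1 / 2 * (t powr (2 * H) + s powr (2 * H) - \<bar>t - s\<bar> powr (2 * H))) \<and>
     (\<forall>\<omega>\<in>space M. continuous_on {0..T} (\<lambda>t. B t \<omega>))"

end

theory Submission
  imports Defs
begin

text \<open>
  The law of \<open>F\<close> is estimated by varying a single Gaussian coordinate. Put
  \<open>\<xi> = B\<^bsub>T\<^esub> / T\<^bsup>H\<^esup>\<close>, a standard normal variable, and \<open>h(s) = E[B\<^bsub>s\<^esub> \<xi>]\<close>. Then
  \<open>B\<^bsub>s\<^esub> = Z\<^bsub>s\<^esub> + h(s) \<xi>\<close>, where the process \<open>Z\<close> is uncorrelated with \<open>\<xi>\<close> and hence independent of it.
  The covariances \<open>h(s)\<close> are nonnegative, so for a frozen path of \<open>Z\<close> the functional \<open>F = f(\<xi>)\<close> is an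
  increasing convex function of \<open>\<xi>\<close>, with derivative
  \<open>D = \<sigma> \<integral> h(s) exp (a s + \<sigma> B\<^bsub>s\<^esub>) ds\<close>.

  For such an \<open>f\<close> the density of \<open>f(\<xi>)\<close> at \<open>x = f(y)\<close> is \<open>\<phi>(y) / f'(y)\<close>, with \<open>\<phi>\<close> the normal density.
  Since \<open>\<phi>'(t) = - t \<phi>(t)\<close>, the value \<open>\<phi>(y)\<close> is at most the integral of \<open>\<bar>t\<bar> \<phi>(t)\<close> over \<open>t \<le> y\<close>, and
  \<open>1 / f'(y) \<le> 1 / f'(t)\<close> there by convexity. Averaging over \<open>Z\<close>, the law of \<open>F\<close> has at \<open>x\<close> a density of
  at most \<open>E[\<bar>\<xi>\<bar> / D; F \<le> x]\<close>; this is the content of \<open>law_bound\<close>. By the arithmetic-geometric mean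
  inequality that expectation is at most
  \<open>\<epsilon> E[(\<xi> / D)\<^sup>2] / 2 + P(F \<le> x) / (2 \<epsilon>)\<close> for each \<open>\<epsilon> > 0\<close>.

  Both terms are controlled by negative moments. By Jensen's inequality
  (\<open>exp_integral_negative_power\<close>) a negative power of an average of exponentials is at most the
  average of the negative powers, so the Gaussian exponential moments show that \<open>1 / D\<close> has all
  moments and that \<open>E[(F/T)\<^bsup>-p\<^esup>] \<le> exp (p \<bar>a\<bar> T + p\<^sup>2 \<sigma>\<^sup>2 T\<^bsup>2H\<^esup> / 2)\<close>. Markov's inequality with the optimal
  \<open>p\<close> then yields \<open>P(F \<le> x) \<le> exp (- (ln x - k)\<^sup>2 / (2 \<sigma>\<^sup>2 T\<^bsup>2H\<^esup>))\<close> for \<open>ln x \<le> k = ln T - \<bar>a\<bar> T\<close>.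
  With \<open>\<epsilon>\<close> the square root of this bound, the density is \<open>O(\<epsilon>)\<close>, that is, the constant \<open>2\<close> becomes
  \<open>4\<close>. The remaining gap between \<open>4\<close> and \<open>8\<close> allows the centre \<open>k\<close> to be replaced by any other
  number, in particular by \<open>E[ln F]\<close>, and the factor \<open>1 / x\<close> is bounded below on the range considered.

  Independence of \<open>\<xi>\<close> and the whole process \<open>Z\<close> is derived from one-dimensional uniqueness of
  characteristic functions, by exchanging exponentials for indicators one coordinate at a time
  (\<open>cylinder_char_zero\<close>).
\<close>

section \<open>Weights with vanishing Fourier transform\<close>

text \<open>The positive and the negative part of the weight \<open>D\<close> have the same mass (take \<open>u = 0\<close>). After
  normalisation they give two laws of \<open>X\<close> with equal characteristic functions, hence equal laws.\<close>

lemma fourier_zero_imp_indicator_zero_real: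
  fixes X D :: "'a \<Rightarrow> real"
  assumes X [measurable]: "X \<in> borel_measurable M" and D: "integrable M D"
    and zero: "\<And>u. (\<integral>\<omega>. iexp (u * X \<omega>) * complex_of_real (D \<omega>) \<partial>M) = 0"
    and A [measurable]: "A \<in> sets borel"
  shows "(\<integral>\<omega>. indicator A (X \<omega>) * D \<omega> \<partial>M) = 0"
proof -
  note Dm [measurable] = borel_measurable_integrable[OF D]
  define P Q where "P \<omega> = max (D \<omega>) 0" and "Q \<omega> = max (- D \<omega>) 0" for \<omega>
  have PQ: "D \<omega> = P \<omega> - Q \<omega>" "0 \<le> P \<omega>" "0 \<le> Q \<omega>" for \<omega>
    by (auto simp: P_def Q_def)
  have intP: "integrable M P" and intQ: "integrable M Q"
    unfolding P_def [abs_def] Q_def [abs_def] using D by auto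
  note Pm [measurable] = borel_measurable_integrable[OF intP]
  note Qm [measurable] = borel_measurable_integrable[OF intQ]
  have iexpP: "integrable M (\<lambda>\<omega>. iexp (u * X \<omega>) * complex_of_real (R \<omega>))"
    if "integrable M R" for u R
    by (rule Bochner_Integration.integrable_bound[OF that])
       (use that borel_measurable_integrable[OF that] in \<open>auto simp: norm_mult\<close>)
  have eqPQ: "(\<integral>\<omega>. iexp (u * X \<omega>) * complex_of_real (P \<omega>) \<partial>M)
      = (\<integral>\<omega>. iexp (u * X \<omega>) * complex_of_real (Q \<omega>) \<partial>M)" for u
  proof -
    have "(\<integral>\<omega>. iexp (u * X \<omega>) * complex_of_real (P \<omega>) \<partial>M)
      - (\<integral>\<omega>. iexp (u * X \<omega>) * complex_of_real (Q \<omega>) \<partial>M)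
      = (\<integral>\<omega>. iexp (u * X \<omega>) * complex_of_real (D \<omega>) \<partial>M)"
      using iexpP[OF intP, of u] iexpP[OF intQ, of u]
      by (simp add: PQ(1) right_diff_distrib)
    with zero[of u] show ?thesis by simp
  qed
  define p where "p = (\<integral>\<omega>. P \<omega> \<partial>M)"
  have pQ: "p = (\<integral>\<omega>. Q \<omega> \<partial>M)"
    using eqPQ[of 0] unfolding p_def by simp
  have p0: "0 \<le> p" unfolding p_def by (simp add: PQ)
  show ?thesis
  proof (cases "p = 0")
    case True
    have "AE \<omega> in M. P \<omega> = 0" "AE \<omega> in M. Q \<omega> = 0"
      using True pQ integral_nonneg_eq_0_iff_AE[OF intP] integral_nonneg_eq_0_iff_AE[OF intQ]
      by (auto simp: p_def PQ)
    then have "AE \<omega> in M. indicator A (X \<omega>) * D \<omega> = 0"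
      by eventually_elim (simp add: PQ)
    then show ?thesis by (rule integral_eq_zero_AE)
  next
    case False
    with p0 have p: "0 < p" by simp
    define law where "law R = distr (density M (\<lambda>\<omega>. ennreal (R \<omega> / p))) borel X" for R
    have law: "real_distribution (law R)"
      "char (law R) u = (\<integral>\<omega>. iexp (u * X \<omega>) * complex_of_real (R \<omega>) \<partial>M) / p"
      "measure (law R) A = (\<integral>\<omega>. indicator A (X \<omega>) * R \<omega> \<partial>M) / p"
      if intR: "integrable M R" and R0: "\<And>\<omega>. 0 \<le> R \<omega>" and Rp: "(\<integral>\<omega>. R \<omega> \<partial>M) = p" for R u
    proof -
      note [measurable] = borel_measurable_integrable[OF intR]
      have "(\<integral>\<^sup>+\<omega>. ennreal (R \<omega> / p) \<partial>M) = ennreal (\<integral>\<omega>. R \<omega> / p \<partial>M)"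
        by (rule nn_integral_eq_integral) (use intR R0 p in auto)
      then have "prob_space (density M (\<lambda>\<omega>. ennreal (R \<omega> / p)))"
        by (intro prob_spaceI) (use Rp p in \<open>simp add: emeasure_density\<close>)
      then show rd: "real_distribution (law R)"
        unfolding law_def real_distribution_def real_distribution_axioms_def
        by (auto intro!: prob_space.prob_space_distr)
      have "char (law R) u = (\<integral>\<omega>. (R \<omega> / p) *\<^sub>R iexp (u * X \<omega>) \<partial>M)"
        unfolding law_def char_def
        by (subst integral_distr, simp, simp, subst integral_density) (use R0 p in auto)
      also have "\<dots> = (\<integral>\<omega>. (iexp (u * X \<omega>) * complex_of_real (R \<omega>)) / p \<partial>M)"
        by (intro Bochner_Integration.integral_cong) (auto simp: scaleR_conv_of_real)
      finally show "char (law R) u = (\<integral>\<omega>. iexp (u * X \<omega>) * complex_of_real (R \<omega>) \<partial>M) / p"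
        by simp
      have "measure (law R) A = (\<integral>x. indicator A x \<partial>law R)"
        by (simp add: law_def)
      also have "\<dots> = (\<integral>\<omega>. (R \<omega> / p) *\<^sub>R indicator A (X \<omega>) \<partial>M)"
        unfolding law_def
        by (subst integral_distr, simp, simp, subst integral_density) (use R0 p in auto)
      also have "\<dots> = (\<integral>\<omega>. (indicator A (X \<omega>) * R \<omega>) / p \<partial>M)"
        by (intro Bochner_Integration.integral_cong) auto
      finally show "measure (law R) A = (\<integral>\<omega>. indicator A (X \<omega>) * R \<omega> \<partial>M) / p" by simp
    qed
    note lawP = law[OF intP PQ(2) p_def[symmetric]] and lawQ = law[OF intQ PQ(3) pQ[symmetric]]
    have "law P = law Q"
      by (rule Levy_uniqueness[OF lawP(1) lawQ(1)]) (intro ext, simp only: lawP(2) lawQ(2) eqPQ)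
    then have "measure (law P) A = measure (law Q) A" by simp
    then have "(\<integral>\<omega>. indicator A (X \<omega>) * P \<omega> \<partial>M) = (\<integral>\<omega>. indicator A (X \<omega>) * Q \<omega> \<partial>M)"
      using p by (simp add: lawP lawQ)
    moreover have "integrable M (\<lambda>\<omega>. indicator A (X \<omega>) * R \<omega>)" if "integrable M R" for R :: "'a \<Rightarrow> real"
      by (rule Bochner_Integration.integrable_bound[OF that])
         (use borel_measurable_integrable[OF that] in \<open>auto simp: indicator_def\<close>)
    ultimately show ?thesis
      using intP intQ by (simp add: PQ(1) right_diff_distrib)
  qed
qed

text \<open>The hypothesis is invariant under conjugation, because \<open>u\<close> ranges over both signs; therefore the
  real and imaginary parts of \<open>D\<close> satisfy it separately.\<close>

lemma fourier_zero_imp_indicator_zero: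
  fixes X :: "'a \<Rightarrow> real" and D :: "'a \<Rightarrow> complex"
  assumes X [measurable]: "X \<in> borel_measurable M" and D: "integrable M D"
    and zero: "\<And>u. (\<integral>\<omega>. iexp (u * X \<omega>) * D \<omega> \<partial>M) = 0"
    and A [measurable]: "A \<in> sets borel"
  shows "(\<integral>\<omega>. complex_of_real (indicator A (X \<omega>)) * D \<omega> \<partial>M) = 0"
proof -
  note Dm [measurable] = borel_measurable_integrable[OF D]
  have int: "integrable M (\<lambda>\<omega>. iexp (u * X \<omega>) * D \<omega>)" for u
    by (rule Bochner_Integration.integrable_bound[OF D]) (auto simp: norm_mult)
  have intc: "integrable M (\<lambda>\<omega>. iexp (u * X \<omega>) * cnj (D \<omega>))" for u
    by (rule Bochner_Integration.integrable_bound[OF D])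
       (use borel_measurable_integrable[OF integrable_cnj[OF D]] in \<open>auto simp: norm_mult\<close>)
  have cnjz: "(\<integral>\<omega>. iexp (u * X \<omega>) * cnj (D \<omega>) \<partial>M) = 0" for u
  proof -
    have "(\<integral>\<omega>. iexp (u * X \<omega>) * cnj (D \<omega>) \<partial>M) = (\<integral>\<omega>. cnj (iexp ((-u) * X \<omega>) * D \<omega>) \<partial>M)"
      by (intro Bochner_Integration.integral_cong) (auto simp: exp_cnj)
    also have "\<dots> = cnj (\<integral>\<omega>. iexp ((-u) * X \<omega>) * D \<omega> \<partial>M)"
      by (rule Bochner_Integration.integral_cnj)
    finally show ?thesis by (simp only: zero complex_cnj_zero)
  qed
  have Re0: "(\<integral>\<omega>. indicator A (X \<omega>) * Re (D \<omega>) \<partial>M) = 0"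
  proof (rule fourier_zero_imp_indicator_zero_real[OF X _ _ A])
    fix u
    have "(\<integral>\<omega>. iexp (u * X \<omega>) * complex_of_real (Re (D \<omega>)) \<partial>M)
      = (\<integral>\<omega>. (iexp (u * X \<omega>) * D \<omega> + iexp (u * X \<omega>) * cnj (D \<omega>)) / 2 \<partial>M)"
      by (intro Bochner_Integration.integral_cong)
         (simp_all add: complex_add_cnj distrib_left[symmetric])
    also have "\<dots> = 0"
      using int[of u] intc[of u] zero[of u] cnjz[of u] by simp
    finally show "(\<integral>\<omega>. iexp (u * X \<omega>) * complex_of_real (Re (D \<omega>)) \<partial>M) = 0" .
  qed (use D in simp)
  have Im0: "(\<integral>\<omega>. indicator A (X \<omega>) * Im (D \<omega>) \<partial>M) = 0"
  proof (rule fourier_zero_imp_indicator_zero_real[OF X _ _ A])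
    fix u
    have "(\<integral>\<omega>. iexp (u * X \<omega>) * complex_of_real (Im (D \<omega>)) \<partial>M)
      = (\<integral>\<omega>. (iexp (u * X \<omega>) * D \<omega> - iexp (u * X \<omega>) * cnj (D \<omega>)) / (2 * \<i>) \<partial>M)"
    proof (intro Bochner_Integration.integral_cong refl)
      fix \<omega>
      have "iexp (u * X \<omega>) * D \<omega> - iexp (u * X \<omega>) * cnj (D \<omega>)
        = (iexp (u * X \<omega>) * complex_of_real (Im (D \<omega>))) * (2 * \<i>)"
        by (simp add: complex_diff_cnj right_diff_distrib[symmetric])
      then show "iexp (u * X \<omega>) * complex_of_real (Im (D \<omega>))
        = (iexp (u * X \<omega>) * D \<omega> - iexp (u * X \<omega>) * cnj (D \<omega>)) / (2 * \<i>)"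
        by (subst nonzero_eq_divide_eq) simp_all
    qed
    also have "\<dots> = 0"
      using int[of u] intc[of u] zero[of u] cnjz[of u] by simp
    finally show "(\<integral>\<omega>. iexp (u * X \<omega>) * complex_of_real (Im (D \<omega>)) \<partial>M) = 0" .
  qed (use D in simp)
  have "integrable M (\<lambda>\<omega>. complex_of_real (indicator A (X \<omega>)) * D \<omega>)"
    by (rule Bochner_Integration.integrable_bound[OF D]) (auto simp: norm_mult indicator_def)
  then show ?thesis
    using Re0 Im0 by (intro complex_eqI) (simp_all flip: integral_Re integral_Im)
qed

section \<open>Centred Gaussian variables\<close>

text \<open>Writing normal laws as images of the standard one treats the point mass \<open>s = 0\<close> together with the
  absolutely continuous case.\<close>

lemma normal_law_eq_scaled:
  assumes "0 \<le> s"
  shows "normal_law \<mu> s = distr std_normal_distribution borel (\<lambda>x. \<mu> + s * x)"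
proof (cases "s = 0")
  case True
  interpret N: real_distribution std_normal_distribution by (rule real_dist_normal_dist)
  show ?thesis
    using True by (simp add: normal_law_def N.distr_const)
next
  case False
  with assms have s: "0 < s" by simp
  interpret N: real_distribution std_normal_distribution by (rule real_dist_normal_dist)
  have "distributed std_normal_distribution lborel (\<lambda>x. x) (normal_density 0 1)"
    unfolding distributed_def by (auto simp: distr_id2)
  from N.normal_density_affine[OF this, of s \<mu>] s
  have "distr std_normal_distribution lborel (\<lambda>x. \<mu> + s * x) = density lborel (normal_density \<mu> s)"
    by (simp add: distributed_def)
  moreover have "distr std_normal_distribution borel (\<lambda>x. \<mu> + s * x)
    = distr std_normal_distribution lborel (\<lambda>x. \<mu> + s * x)"
    by (intro distr_cong) auto
  ultimately show ?thesis using s by (simp add: normal_law_def)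
qed

lemma centered_gaussian_scaled:
  assumes "prob_space M" and X: "gaussian_rv M X" and mean: "(\<integral>\<omega>. X \<omega> \<partial>M) = 0"
  obtains s where "0 \<le> s" "distr M borel X = distr std_normal_distribution borel (\<lambda>x. s * x)"
proof -
  interpret N: real_distribution std_normal_distribution by (rule real_dist_normal_dist)
  from X obtain \<mu> s where [measurable]: "X \<in> borel_measurable M" and s: "0 \<le> s"
    and d: "distr M borel X = normal_law \<mu> s"
    by (auto simp: gaussian_rv_def)
  have "(\<integral>\<omega>. X \<omega> \<partial>M) = (\<integral>x. x \<partial>distr M borel X)"
    by (simp add: integral_distr)
  also have "\<dots> = (\<integral>x. \<mu> + s * x \<partial>std_normal_distribution)"
    by (simp add: d normal_law_eq_scaled[OF s] integral_distr)
  also have "\<dots> = \<mu>"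
    using integrable_std_normal_distribution_moment[of 1]
      integral_std_normal_distribution_moment_odd[of 1]
    by (simp add: N.prob_space[simplified])
  finally have "\<mu> = 0" using mean by simp
  with d s show thesis
    by (intro that[of s]) (simp_all add: normal_law_eq_scaled[OF s])
qed

lemma centered_gaussian_square:
  assumes M: "prob_space M" and X: "gaussian_rv M X" and mean: "(\<integral>\<omega>. X \<omega> \<partial>M) = 0"
  shows "integrable M (\<lambda>\<omega>. (X \<omega>)\<^sup>2)"
    and "distr M borel X = distr std_normal_distribution borel (\<lambda>x. sqrt (\<integral>\<omega>. (X \<omega>)\<^sup>2 \<partial>M) * x)"
proof -
  have [measurable]: "X \<in> borel_measurable M"
    using X by (simp add: gaussian_rv_def)
  obtain s where s: "0 \<le> s"
    and d: "distr M borel X = distr std_normal_distribution borel (\<lambda>x. s * x)"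
    by (rule centered_gaussian_scaled[OF assms])
  have "integrable std_normal_distribution (\<lambda>x. s\<^sup>2 * x\<^sup>2)"
    using integrable_std_normal_distribution_moment[of 2] by simp
  then have "integrable (distr M borel X) (\<lambda>x. x\<^sup>2)"
    unfolding d by (simp add: integrable_distr_eq power_mult_distrib)
  then show "integrable M (\<lambda>\<omega>. (X \<omega>)\<^sup>2)"
    by (simp add: integrable_distr_eq)
  have "(\<integral>\<omega>. (X \<omega>)\<^sup>2 \<partial>M) = (\<integral>x. x\<^sup>2 \<partial>distr M borel X)"
    by (simp add: integral_distr)
  also have "\<dots> = s\<^sup>2 * (\<integral>x. x\<^sup>2 \<partial>std_normal_distribution)"
    unfolding d by (simp add: integral_distr power_mult_distrib)
  also have "\<dots> = s\<^sup>2"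
    using std_normal_distribution_even_moments(1)[of 1] by simp
  finally have "sqrt (\<integral>\<omega>. (X \<omega>)\<^sup>2 \<partial>M) = s" using s by simp
  then show "distr M borel X = distr std_normal_distribution borel (\<lambda>x. sqrt (\<integral>\<omega>. (X \<omega>)\<^sup>2 \<partial>M) * x)"
    using d by simp
qed

lemma centered_gaussian_char:
  assumes M: "prob_space M" and X: "gaussian_rv M X" and mean: "(\<integral>\<omega>. X \<omega> \<partial>M) = 0"
  shows "(\<integral>\<omega>. iexp (X \<omega>) \<partial>M) = complex_of_real (exp (- (\<integral>\<omega>. (X \<omega>)\<^sup>2 \<partial>M) / 2))"
proof -
  have [measurable]: "X \<in> borel_measurable M"
    using X by (simp add: gaussian_rv_def)
  let ?s = "sqrt (\<integral>\<omega>. (X \<omega>)\<^sup>2 \<partial>M)"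
  have "(\<integral>\<omega>. iexp (X \<omega>) \<partial>M) = (\<integral>x. iexp x \<partial>distr M borel X)"
    by (simp add: integral_distr)
  also have "\<dots> = char std_normal_distribution ?s"
    unfolding centered_gaussian_square(2)[OF assms] char_def by (simp add: integral_distr)
  also have "\<dots> = complex_of_real (exp (- ?s\<^sup>2 / 2))"
    by (simp add: char_std_normal_distribution)
  finally show ?thesis by simp
qed

lemma centered_gaussian_exp_moment:
  assumes M: "prob_space M" and X: "gaussian_rv M X" and mean: "(\<integral>\<omega>. X \<omega> \<partial>M) = 0"
  shows "(\<integral>\<^sup>+\<omega>. ennreal (exp (l * X \<omega>)) \<partial>M) = ennreal (exp (l\<^sup>2 * (\<integral>\<omega>. (X \<omega>)\<^sup>2 \<partial>M) / 2))"
proof -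
  have [measurable]: "X \<in> borel_measurable M"
    using X by (simp add: gaussian_rv_def)
  let ?s = "sqrt (\<integral>\<omega>. (X \<omega>)\<^sup>2 \<partial>M)"
  \<comment> \<open>Completing the square turns the exponential factor into a shift of the normal density.\<close>
  have "(\<integral>\<^sup>+\<omega>. ennreal (exp (l * X \<omega>)) \<partial>M) = (\<integral>\<^sup>+x. ennreal (exp (l * x)) \<partial>distr M borel X)"
    by (simp add: nn_integral_distr)
  also have "\<dots> = (\<integral>\<^sup>+x. ennreal (exp (l * (?s * x))) \<partial>std_normal_distribution)"
    unfolding centered_gaussian_square(2)[OF assms] by (simp add: nn_integral_distr)
  also have "\<dots> = (\<integral>\<^sup>+x. ennreal (exp ((l * ?s)\<^sup>2 / 2)) * ennreal (normal_density (l * ?s) 1 x) \<partial>lborel)"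
  proof (subst nn_integral_density, simp, simp, intro nn_integral_cong)
    fix x :: real
    have "- x\<^sup>2 / 2 + l * (?s * x) = (l * ?s)\<^sup>2 / 2 + - (x - l * ?s)\<^sup>2 / 2"
      by (simp only: power2_eq_square) (simp add: field_simps)
    then have "exp (- x\<^sup>2 / 2) * exp (l * (?s * x)) = exp ((l * ?s)\<^sup>2 / 2) * exp (- (x - l * ?s)\<^sup>2 / 2)"
      by (simp only: flip: exp_add)
    then have "std_normal_density x * exp (l * (?s * x)) = exp ((l * ?s)\<^sup>2 / 2) * normal_density (l * ?s) 1 x"
      by (simp add: normal_density_def)
    then show "ennreal (std_normal_density x) * ennreal (exp (l * (?s * x)))
        = ennreal (exp ((l * ?s)\<^sup>2 / 2)) * ennreal (normal_density (l * ?s) 1 x)"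
      by (metis ennreal_mult' exp_ge_zero normal_density_nonneg mult.commute)
  qed
  also have "\<dots> = ennreal (exp ((l * ?s)\<^sup>2 / 2)) * (\<integral>\<^sup>+x. ennreal (normal_density (l * ?s) 1 x) \<partial>lborel)"
    by (rule nn_integral_cmult) simp
  also have "(\<integral>\<^sup>+x. ennreal (normal_density (l * ?s) 1 x) \<partial>lborel) = 1"
    by (subst nn_integral_eq_integral) auto
  finally show ?thesis by (simp add: power_mult_distrib)
qed

section \<open>Independence of a variable and a process\<close>

text \<open>The \<open>\<sigma>\<close>-algebra generated by \<open>(Z t)\<close>, \<open>t \<in> I\<close>. It is presented by finite-dimensional cylinders,
  which form a \<open>\<pi>\<close>-system; carrying the algebra on the original sample space keeps the paths of \<open>Z\<close>
  available, including their continuity.\<close>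

definition process_algebra :: "'a measure \<Rightarrow> 'i set \<Rightarrow> ('i \<Rightarrow> 'a \<Rightarrow> real) \<Rightarrow> 'a measure" where
  "process_algebra M I Z = sigma (space M)
     {{\<omega> \<in> space M. \<forall>t\<in>K. Z t \<omega> \<in> A t} | K A. finite K \<and> K \<subseteq> I \<and> (\<forall>t. A t \<in> sets borel)}"

lemma space_process_algebra [simp]: "space (process_algebra M I Z) = space M"
  by (simp add: process_algebra_def space_measure_of_conv)

lemma measurable_process_algebra:
  assumes "t \<in> I"
  shows "Z t \<in> borel_measurable (process_algebra M I Z)"
proof (rule measurableI)
  fix A :: "real set" assume "A \<in> sets borel"
  then have "{\<omega> \<in> space M. \<forall>s\<in>{t}. Z s \<omega> \<in> (\<lambda>_. A) s} \<in>
    {{\<omega> \<in> space M. \<forall>t\<in>K. Z t \<omega> \<in> A t} | K A. finite K \<and> K \<subseteq> I \<and> (\<forall>t. A t \<in> sets borel)}"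
    using assms by (intro CollectI exI[of _ "{t}"] exI[of _ "\<lambda>_. A"]) auto
  then have "{\<omega> \<in> space M. \<forall>s\<in>{t}. Z s \<omega> \<in> (\<lambda>_. A) s} \<in> sets (process_algebra M I Z)"
    unfolding process_algebra_def by (subst sets_measure_of) auto
  then show "Z t -` A \<inter> space (process_algebra M I Z) \<in> sets (process_algebra M I Z)"
    by (simp add: vimage_def Int_def conj_commute)
qed simp

text \<open>A weight orthogonal to all exponentials of linear combinations of the \<open>Z t\<close> is orthogonal to all
  cylinder indicators. The exponentials are exchanged for indicators one coordinate \<open>s\<close> at a time: with
  the other factors as weight, the hypothesis for the combinations with varying coefficient \<open>u\<close>
  of \<open>Z s\<close> is a vanishing Fourier transform in \<open>Z s\<close>.\<close>

lemma (in prob_space) cylinder_char_zero: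
  fixes Z :: "'i \<Rightarrow> 'a \<Rightarrow> real" and D :: "'a \<Rightarrow> complex"
  assumes Z: "\<And>t. t \<in> I \<Longrightarrow> Z t \<in> borel_measurable M" and D: "integrable M D"
    and zero: "\<And>J c. finite J \<Longrightarrow> J \<subseteq> I \<Longrightarrow> expectation (\<lambda>\<omega>. D \<omega> * iexp (\<Sum>t\<in>J. c t * Z t \<omega>)) = 0"
    and A: "\<And>t. A t \<in> sets borel"
    and K: "finite K" "K \<subseteq> I" and J: "finite J" "J \<subseteq> I"
  shows "expectation (\<lambda>\<omega>. D \<omega> * complex_of_real (\<Prod>t\<in>K. indicator (A t) (Z t \<omega>)) *
      iexp (\<Sum>t\<in>J. c t * Z t \<omega>)) = 0"
  using K J
proof (induction K arbitrary: J c rule: finite_induct)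
  case empty
  then show ?case using zero[of J c] by simp
next
  case (insert s K)
  note [measurable] = Z A borel_measurable_integrable[OF D]
  have [measurable]: "Z s \<in> borel_measurable M" using insert.prems Z by auto
  have K: "t \<in> K \<Longrightarrow> Z t \<in> borel_measurable M" for t using insert.prems Z by auto
  have J: "t \<in> J \<Longrightarrow> Z t \<in> borel_measurable M" for t using insert.prems Z by auto
  let ?P = "\<lambda>\<omega>. \<Prod>t\<in>K. indicator (A t) (Z t \<omega>) :: real"
  let ?D = "\<lambda>\<omega>. D \<omega> * complex_of_real (?P \<omega>) * iexp (\<Sum>t\<in>J. c t * Z t \<omega>)"
  have [measurable]: "?P \<in> borel_measurable M"
    by (intro borel_measurable_prod) (use K in measurable)
  have [measurable]: "(\<lambda>\<omega>. \<Sum>t\<in>J. c t * Z t \<omega>) \<in> borel_measurable M"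
    by (intro borel_measurable_sum) (use J in measurable)
  have P01: "0 \<le> ?P \<omega>" "?P \<omega> \<le> 1" for \<omega>
    by (auto intro!: prod_nonneg prod_le_1)
  have intD: "integrable M ?D"
    by (rule Bochner_Integration.integrable_bound[OF D])
       (use P01 in \<open>auto simp: norm_mult mult_left_le simp del: of_real_prod of_real_sum\<close>)
  have "expectation (\<lambda>\<omega>. complex_of_real (indicator (A s) (Z s \<omega>)) * ?D \<omega>) = 0"
  proof (rule fourier_zero_imp_indicator_zero[OF _ intD])
    fix u
    let ?c = "\<lambda>t. (if t \<in> J then c t else 0) + (if t = s then u else 0)"
    have sum: "(\<Sum>t\<in>insert s J. ?c t * Z t \<omega>) = u * Z s \<omega> + (\<Sum>t\<in>J. c t * Z t \<omega>)" for \<omega>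
    proof -
      have "(\<Sum>t\<in>insert s J. ?c t * Z t \<omega>)
        = (\<Sum>t\<in>insert s J. if t \<in> J then c t * Z t \<omega> else 0)
          + (\<Sum>t\<in>insert s J. if t = s then u * Z t \<omega> else 0)"
        by (subst sum.distrib[symmetric]) (auto intro!: sum.cong simp: distrib_right)
      also have "(\<Sum>t\<in>insert s J. if t \<in> J then c t * Z t \<omega> else 0) = (\<Sum>t\<in>J. c t * Z t \<omega>)"
        using insert.prems by (intro sum.mono_neutral_cong_right) auto
      also have "(\<Sum>t\<in>insert s J. if t = s then u * Z t \<omega> else 0) = u * Z s \<omega>"
        using insert.prems by (simp add: sum.delta)
      finally show ?thesis by simp
    qed
    have "expectation (\<lambda>\<omega>. iexp (u * Z s \<omega>) * ?D \<omega>) =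
      expectation (\<lambda>\<omega>. D \<omega> * complex_of_real (?P \<omega>) * iexp (\<Sum>t\<in>insert s J. ?c t * Z t \<omega>))"
      unfolding sum
      by (intro Bochner_Integration.integral_cong refl) (simp add: distrib_left exp_add)
    also have "\<dots> = 0"
      using insert.prems by (intro insert.IH) auto
    finally show "expectation (\<lambda>\<omega>. iexp (u * Z s \<omega>) * ?D \<omega>) = 0" .
  qed measurable
  also have "(\<lambda>\<omega>. complex_of_real (indicator (A s) (Z s \<omega>)) * ?D \<omega>)
    = (\<lambda>\<omega>. D \<omega> * complex_of_real (\<Prod>t\<in>insert s K. indicator (A t) (Z t \<omega>)) *
      iexp (\<Sum>t\<in>J. c t * Z t \<omega>))"
    using insert.hyps by (simp add: ac_simps)
  finally show ?case .
qed

text \<open>If characteristic functions factorise, \<open>X\<close> is independent of the \<open>\<sigma>\<close>-algebra of the process. The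
  conclusion is stated as a product law for \<open>\<omega> \<mapsto> (X \<omega>, \<omega>)\<close>, so that it applies to functionals of
  \<open>X\<close> and of an entire path of \<open>Z\<close>.\<close>

lemma (in prob_space) product_law_process_algebra:
  fixes X :: "'a \<Rightarrow> real" and Z :: "'i \<Rightarrow> 'a \<Rightarrow> real"
  assumes X [measurable]: "X \<in> borel_measurable M"
    and Z: "\<And>t. t \<in> I \<Longrightarrow> Z t \<in> borel_measurable M"
    and char: "\<And>v J c. finite J \<Longrightarrow> J \<subseteq> I \<Longrightarrow>
      expectation (\<lambda>\<omega>. iexp (v * X \<omega> + (\<Sum>t\<in>J. c t * Z t \<omega>)))
      = expectation (\<lambda>\<omega>. iexp (v * X \<omega>)) * expectation (\<lambda>\<omega>. iexp (\<Sum>t\<in>J. c t * Z t \<omega>))"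
  shows "sets (process_algebra M I Z) \<subseteq> sets M"
    and "distr M (borel \<Otimes>\<^sub>M process_algebra M I Z) (\<lambda>\<omega>. (X \<omega>, \<omega>))
      = distr M borel X \<Otimes>\<^sub>M distr M (process_algebra M I Z) (\<lambda>\<omega>. \<omega>)"
proof -
  let ?E = "{{\<omega> \<in> space M. \<forall>t\<in>K. Z t \<omega> \<in> A t} | K A. finite K \<and> K \<subseteq> I \<and> (\<forall>t. A t \<in> sets borel)}"
  let ?G = "{X -` A \<inter> space M | A. A \<in> sets borel}"
  have cyl: "{\<omega> \<in> space M. \<forall>t\<in>K. Z t \<omega> \<in> A t} \<in> events"
    if "finite K" "K \<subseteq> I" "\<And>t. A t \<in> sets borel" for K A
  proof -
    have "{\<omega> \<in> space M. Z t \<omega> \<in> A t} \<in> events" if "t \<in> K" for t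
      using measurable_sets[OF Z[of t] \<open>A t \<in> sets borel\<close>] that \<open>K \<subseteq> I\<close>
      by (auto simp: vimage_def Int_def conj_commute)
    then show ?thesis using \<open>finite K\<close> by (rule sets.sets_Collect_finite_All)
  qed
  then have E: "?E \<subseteq> events" by auto
  have alg: "sets (process_algebra M I Z) = sigma_sets (space M) ?E"
    unfolding process_algebra_def by (rule sets_measure_of) auto
  show sub: "sets (process_algebra M I Z) \<subseteq> sets M"
    unfolding alg by (rule sets.sigma_sets_subset[OF E])
  have "indep_set ?G ?E"
  proof (rule indep_setI)
    show "?G \<subseteq> events" by auto
    show "?E \<subseteq> events" by (rule E)
    fix a b assume "a \<in> ?G" "b \<in> ?E"
    then obtain S K A where a: "a = X -` S \<inter> space M" and S [measurable]: "S \<in> sets borel"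
      and b: "b = {\<omega> \<in> space M. \<forall>t\<in>K. Z t \<omega> \<in> A t}"
      and K: "finite K" "K \<subseteq> I" and A: "\<And>t. A t \<in> sets borel"
      by auto
    have [measurable]: "b \<in> events" unfolding b by (rule cyl[OF K A])
    have [measurable]: "a \<in> events" unfolding a by simp
    have ind: "(\<Prod>t\<in>K. indicator (A t) (Z t \<omega>) :: real) = indicator b \<omega>" if "\<omega> \<in> space M" for \<omega>
      using that K(1) unfolding b by (auto simp: indicator_def prod.neutral)
    have intX: "integrable M (\<lambda>\<omega>. iexp (v * X \<omega>))" for v
      by (rule integrable_iexp) auto
    have intXb: "integrable M (\<lambda>\<omega>. iexp (v * X \<omega>) * complex_of_real (indicator b \<omega>))" for v
      by (rule Bochner_Integration.integrable_bound[OF intX[of v]]) (auto simp: norm_mult indicator_def)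
    \<comment> \<open>The centred weight \<open>iexp (v X) - E[iexp (v X)]\<close> is orthogonal to every \<open>iexp\<close> of the process.\<close>
    have split: "expectation (\<lambda>\<omega>. iexp (v * X \<omega>) * complex_of_real (indicator b \<omega>))
      = expectation (\<lambda>\<omega>. iexp (v * X \<omega>)) * prob b" for v
    proof -
      let ?m = "expectation (\<lambda>\<omega>. iexp (v * X \<omega>))"
      have "expectation (\<lambda>\<omega>. (iexp (v * X \<omega>) - ?m) * complex_of_real (\<Prod>t\<in>K. indicator (A t) (Z t \<omega>))
          * iexp (\<Sum>t\<in>{}. 0 * Z t \<omega>)) = 0"
      proof (rule cylinder_char_zero[OF Z _ _ A K])
        show "integrable M (\<lambda>\<omega>. iexp (v * X \<omega>) - ?m)" using intX[of v] by simp
        fix J :: "'i set" and c assume J: "finite J" "J \<subseteq> I"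
        have [measurable]: "(\<lambda>\<omega>. \<Sum>t\<in>J. c t * Z t \<omega>) \<in> borel_measurable M"
          by (intro borel_measurable_sum borel_measurable_times Z) (use J in auto)
        have i: "integrable M (\<lambda>\<omega>. iexp (\<Sum>t\<in>J. c t * Z t \<omega>))"
          by (rule integrable_iexp) (simp_all del: of_real_sum)
        have i2: "integrable M (\<lambda>\<omega>. iexp (v * X \<omega> + (\<Sum>t\<in>J. c t * Z t \<omega>)))"
          by (rule integrable_iexp) (simp_all del: of_real_sum)
        have "expectation (\<lambda>\<omega>. (iexp (v * X \<omega>) - ?m) * iexp (\<Sum>t\<in>J. c t * Z t \<omega>))
          = expectation (\<lambda>\<omega>. iexp (v * X \<omega> + (\<Sum>t\<in>J. c t * Z t \<omega>)) - ?m * iexp (\<Sum>t\<in>J. c t * Z t \<omega>))"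
          by (intro Bochner_Integration.integral_cong refl)
             (simp add: left_diff_distrib distrib_left exp_add)
        also have "\<dots> = 0"
          using i i2 char[OF J, of v c]
          by (subst Bochner_Integration.integral_diff) (simp_all del: of_real_sum of_real_add of_real_mult)
        finally show "expectation (\<lambda>\<omega>. (iexp (v * X \<omega>) - ?m) * iexp (\<Sum>t\<in>J. c t * Z t \<omega>)) = 0" .
      qed auto
      also have "expectation (\<lambda>\<omega>. (iexp (v * X \<omega>) - ?m) * complex_of_real (\<Prod>t\<in>K. indicator (A t) (Z t \<omega>))
          * iexp (\<Sum>t\<in>{}. 0 * Z t \<omega>))
        = expectation (\<lambda>\<omega>. iexp (v * X \<omega>) * complex_of_real (indicator b \<omega>) - ?m * complex_of_real (indicator b \<omega>))"
        by (intro Bochner_Integration.integral_cong refl)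
           (simp only: ind, simp add: left_diff_distrib)
      also have "\<dots> = expectation (\<lambda>\<omega>. iexp (v * X \<omega>) * complex_of_real (indicator b \<omega>)) - ?m * prob b"
      proof -
        have "integrable M (\<lambda>\<omega>. complex_of_real (indicator b \<omega>))"
          by (intro integrable_of_real) (simp add: emeasure_eq_measure)
        then show ?thesis
          using intXb[of v]
          by (subst Bochner_Integration.integral_diff) (simp_all add: integral_of_real)
      qed
      finally show ?thesis by simp
    qed
    have intb: "integrable M (\<lambda>\<omega>. indicator b \<omega> - prob b)"
      by (simp add: emeasure_eq_measure)
    \<comment> \<open>Now the centred weight is the indicator of the cylinder, and \<open>X\<close> is the variable to be tested.\<close>
    have "expectation (\<lambda>\<omega>. indicator S (X \<omega>) * (indicator b \<omega> - prob b)) = 0"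
    proof (rule fourier_zero_imp_indicator_zero_real[OF X intb _ S])
      fix u
      have "expectation (\<lambda>\<omega>. iexp (u * X \<omega>) * complex_of_real (indicator b \<omega> - prob b))
        = expectation (\<lambda>\<omega>. iexp (u * X \<omega>) * complex_of_real (indicator b \<omega>) - iexp (u * X \<omega>) * prob b)"
        by (intro Bochner_Integration.integral_cong refl) (simp add: right_diff_distrib)
      also have "\<dots> = 0"
        using intX[of u] intXb[of u] split[of u]
        by (subst Bochner_Integration.integral_diff) simp_all
      finally show "expectation (\<lambda>\<omega>. iexp (u * X \<omega>) * complex_of_real (indicator b \<omega> - prob b)) = 0" .
    qed
    also have "expectation (\<lambda>\<omega>. indicator S (X \<omega>) * (indicator b \<omega> - prob b))
      = expectation (\<lambda>\<omega>. indicator (a \<inter> b) \<omega> - indicator a \<omega> * prob b)"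
      by (intro Bochner_Integration.integral_cong refl) (auto simp: a b indicator_def)
    also have "\<dots> = prob (a \<inter> b) - prob a * prob b"
      by (subst Bochner_Integration.integral_diff) (simp_all add: emeasure_eq_measure)
    finally show "prob (a \<inter> b) = prob a * prob b" by simp
  qed
  moreover have "Int_stable ?G"
  proof (rule Int_stableI)
    fix a b assume "a \<in> ?G" "b \<in> ?G"
    then obtain S S' where "a = X -` S \<inter> space M" "b = X -` S' \<inter> space M" "S \<in> sets borel" "S' \<in> sets borel"
      by auto
    then show "a \<inter> b \<in> ?G"
      by (intro CollectI exI[of _ "S \<inter> S'"]) auto
  qed
  moreover have "Int_stable ?E"
  proof (rule Int_stableI)
    fix a b assume "a \<in> ?E" "b \<in> ?E"
    then obtain K A K' A' where "a = {\<omega> \<in> space M. \<forall>t\<in>K. Z t \<omega> \<in> A t}"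
      "b = {\<omega> \<in> space M. \<forall>t\<in>K'. Z t \<omega> \<in> A' t}"
      "finite K" "K \<subseteq> I" "\<forall>t. A t \<in> sets borel" "finite K'" "K' \<subseteq> I" "\<forall>t. A' t \<in> sets borel"
      by auto
    then show "a \<inter> b \<in> ?E"
      by (intro CollectI exI[of _ "K \<union> K'"]
          exI[of _ "\<lambda>t. (if t \<in> K then A t else UNIV) \<inter> (if t \<in> K' then A' t else UNIV)"]) auto
  qed
  ultimately have ind: "indep_set (sigma_sets (space M) ?G) (sigma_sets (space M) ?E)"
    by (rule indep_set_sigma_sets)
  let ?N = "process_algebra M I Z"
  have id [measurable]: "(\<lambda>\<omega>. \<omega>) \<in> measurable M ?N"
    by (rule measurableI) (use sub sets.sets_into_space in auto)
  interpret X: prob_space "distr M borel X" by (rule prob_space_distr) simp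
  interpret Y: prob_space "distr M ?N (\<lambda>\<omega>. \<omega>)" by (rule prob_space_distr) simp
  have "distr M borel X \<Otimes>\<^sub>M distr M ?N (\<lambda>\<omega>. \<omega>) = distr M (borel \<Otimes>\<^sub>M ?N) (\<lambda>\<omega>. (X \<omega>, \<omega>))"
  proof (rule pair_measure_eqI)
    fix A B
    assume "A \<in> sets (distr M borel X)" "B \<in> sets (distr M ?N (\<lambda>\<omega>. \<omega>))"
    then have A [measurable]: "A \<in> sets borel" and B [measurable]: "B \<in> sets ?N" by simp_all
    have BM: "B \<in> events" and BE: "B \<in> sigma_sets (space M) ?E"
      using B sub by (auto simp: alg)
    have eqs: "B \<inter> space M = B" "(\<lambda>\<omega>. (X \<omega>, \<omega>)) -` (A \<times> B) \<inter> space M = (X -` A \<inter> space M) \<inter> B"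
      using sets.sets_into_space[OF BM] by auto
    have "prob ((X -` A \<inter> space M) \<inter> B) = prob (X -` A \<inter> space M) * prob B"
      by (rule indep_setD[OF ind _ BE]) (use A in \<open>auto intro!: sigma_sets.Basic\<close>)
    then show "emeasure (distr M borel X) A * emeasure (distr M ?N (\<lambda>\<omega>. \<omega>)) B
      = emeasure (distr M (borel \<Otimes>\<^sub>M ?N) (\<lambda>\<omega>. (X \<omega>, \<omega>))) (A \<times> B)"
      by (simp add: emeasure_distr eqs emeasure_eq_measure ennreal_mult'')
  qed (auto intro: X.sigma_finite_measure_axioms Y.sigma_finite_measure_axioms sets_pair_measure_cong)
  then show "distr M (borel \<Otimes>\<^sub>M ?N) (\<lambda>\<omega>. (X \<omega>, \<omega>))
      = distr M borel X \<Otimes>\<^sub>M distr M ?N (\<lambda>\<omega>. \<omega>)" by simp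
qed

section \<open>Splitting off a coordinate of a Gaussian process\<close>

definition lin_comb :: "'i set \<Rightarrow> ('i \<Rightarrow> 'a \<Rightarrow> real) \<Rightarrow> ('a \<Rightarrow> real) \<Rightarrow> bool" where
  "lin_comb I X f \<longleftrightarrow> (\<exists>J c. finite J \<and> J \<subseteq> I \<and> f = (\<lambda>\<omega>. \<Sum>t\<in>J. c t * X t \<omega>))"

lemma lin_combI:
  "finite J \<Longrightarrow> J \<subseteq> I \<Longrightarrow> (\<And>\<omega>. f \<omega> = (\<Sum>t\<in>J. c t * X t \<omega>)) \<Longrightarrow> lin_comb I X f"
  unfolding lin_comb_def by (intro exI[of _ J] exI[of _ c] conjI ext)

lemma lin_comb_single: "t \<in> I \<Longrightarrow> lin_comb I X (X t)"
  unfolding lin_comb_def by (intro exI[of _ "{t}"] exI[of _ "\<lambda>_. 1"]) auto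

lemma lin_comb_scale:
  assumes "lin_comb I X f"
  shows "lin_comb I X (\<lambda>\<omega>. b * f \<omega>)"
proof -
  from assms obtain J c where "finite J" "J \<subseteq> I" "f = (\<lambda>\<omega>. \<Sum>t\<in>J. c t * X t \<omega>)"
    by (auto simp: lin_comb_def)
  then show ?thesis
    unfolding lin_comb_def
    by (intro exI[of _ J] exI[of _ "\<lambda>t. b * c t"]) (auto simp: sum_distrib_left mult.assoc)
qed

lemma lin_comb_add:
  assumes "lin_comb I X f" "lin_comb I X g"
  shows "lin_comb I X (\<lambda>\<omega>. f \<omega> + g \<omega>)"
proof -
  from assms obtain J c J' c' where J: "finite J" "J \<subseteq> I" "f = (\<lambda>\<omega>. \<Sum>t\<in>J. c t * X t \<omega>)"
    and J': "finite J'" "J' \<subseteq> I" "g = (\<lambda>\<omega>. \<Sum>t\<in>J'. c' t * X t \<omega>)"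
    by (auto simp: lin_comb_def)
  have "f \<omega> = (\<Sum>t\<in>J \<union> J'. (if t \<in> J then c t else 0) * X t \<omega>)" for \<omega>
    unfolding J(3) using J J' by (intro sum.mono_neutral_cong_left) auto
  moreover have "g \<omega> = (\<Sum>t\<in>J \<union> J'. (if t \<in> J' then c' t else 0) * X t \<omega>)" for \<omega>
    unfolding J'(3) using J J' by (intro sum.mono_neutral_cong_left) auto
  ultimately have "f \<omega> + g \<omega> = (\<Sum>t\<in>J \<union> J'.
      ((if t \<in> J then c t else 0) + (if t \<in> J' then c' t else 0)) * X t \<omega>)" for \<omega>
    by (simp only: sum.distrib distrib_right)
  then show ?thesis
    by (rule lin_combI[rotated 2]) (use J J' in auto)
qed

lemma lin_comb_sum:
  assumes "finite J" "\<And>t. t \<in> J \<Longrightarrow> lin_comb I X (f t)"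
  shows "lin_comb I X (\<lambda>\<omega>. \<Sum>t\<in>J. f t \<omega>)"
  using assms
proof (induction J rule: finite_induct)
  case empty
  show ?case unfolding lin_comb_def by (intro exI[of _ "{}"]) simp
next
  case (insert t J)
  then show ?case by (simp add: lin_comb_add)
qed

locale centered_gaussian_process = prob_space M for M :: "'a measure" +
  fixes I :: "'i set" and X :: "'i \<Rightarrow> 'a \<Rightarrow> real"
  assumes gaussian: "gaussian_process M I X"
    and centered: "\<And>t. t \<in> I \<Longrightarrow> expectation (X t) = 0"
begin

lemma gaussian_lin_comb: "lin_comb I X f \<Longrightarrow> gaussian_rv M f"
  using gaussian by (auto simp: gaussian_process_def lin_comb_def)

lemma measurable_lin_comb: "lin_comb I X f \<Longrightarrow> f \<in> borel_measurable M"
  using gaussian_lin_comb by (auto simp: gaussian_rv_def)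

lemma integrable_single:
  assumes "t \<in> I"
  shows "integrable M (X t)"
proof -
  have g: "gaussian_rv M (X t)" by (rule gaussian_lin_comb[OF lin_comb_single[OF assms]])
  then have [measurable]: "X t \<in> borel_measurable M" by (simp add: gaussian_rv_def)
  have "integrable M (\<lambda>\<omega>. (X t \<omega>)\<^sup>2)"
    by (rule centered_gaussian_square(1)[OF prob_space_axioms g centered[OF assms]])
  then show ?thesis by (rule square_integrable_imp_integrable[rotated]) simp
qed

lemma expectation_lin_comb: "lin_comb I X f \<Longrightarrow> expectation f = 0"
  by (auto simp: lin_comb_def integrable_single centered subset_iff
      Bochner_Integration.integral_sum intro!: sum.neutral)

lemma
  assumes f: "lin_comb I X f"
  shows square_lin_comb: "integrable M (\<lambda>\<omega>. (f \<omega>)\<^sup>2)"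
    and law_lin_comb: "distr M borel f = distr std_normal_distribution borel (\<lambda>x. sqrt (expectation (\<lambda>\<omega>. (f \<omega>)\<^sup>2)) * x)"
    and char_lin_comb: "expectation (\<lambda>\<omega>. iexp (f \<omega>)) = complex_of_real (exp (- expectation (\<lambda>\<omega>. (f \<omega>)\<^sup>2) / 2))"
    and exp_moment_lin_comb: "(\<integral>\<^sup>+\<omega>. ennreal (exp (l * f \<omega>)) \<partial>M) = ennreal (exp (l\<^sup>2 * expectation (\<lambda>\<omega>. (f \<omega>)\<^sup>2) / 2))"
  using prob_space_axioms gaussian_lin_comb[OF f] expectation_lin_comb[OF f]
  by (rule centered_gaussian_square centered_gaussian_char centered_gaussian_exp_moment)+

lemma integrable_product_lin_comb:
  assumes f: "lin_comb I X f" and g: "lin_comb I X g"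
  shows "integrable M (\<lambda>\<omega>. f \<omega> * g \<omega>)"
proof (rule Bochner_Integration.integrable_bound)
  show "integrable M (\<lambda>\<omega>. (f \<omega>)\<^sup>2 + (g \<omega>)\<^sup>2)"
    using square_lin_comb[OF f] square_lin_comb[OF g] by simp
  have "\<bar>x * y\<bar> \<le> x\<^sup>2 + y\<^sup>2" for x y :: real
  proof -
    have "2 * (\<bar>x\<bar> * \<bar>y\<bar>) \<le> x\<^sup>2 + y\<^sup>2"
      using sum_squares_bound[of "\<bar>x\<bar>" "\<bar>y\<bar>"] by (simp add: mult.assoc)
    moreover have "0 \<le> \<bar>x\<bar> * \<bar>y\<bar>" by simp
    ultimately show ?thesis unfolding abs_mult by linarith
  qed
  then show "AE \<omega> in M. norm (f \<omega> * g \<omega>) \<le> norm ((f \<omega>)\<^sup>2 + (g \<omega>)\<^sup>2)"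
    by simp
qed (use measurable_lin_comb[OF f] measurable_lin_comb[OF g] in measurable)

text \<open>A centred Gaussian characteristic function is determined by the variance, and the variances of
  uncorrelated variables add up.\<close>

lemma char_uncorrelated:
  assumes f: "lin_comb I X f" and g: "lin_comb I X g" and "expectation (\<lambda>\<omega>. f \<omega> * g \<omega>) = 0"
  shows "expectation (\<lambda>\<omega>. iexp (f \<omega> + g \<omega>)) = expectation (\<lambda>\<omega>. iexp (f \<omega>)) * expectation (\<lambda>\<omega>. iexp (g \<omega>))"
proof -
  have fg: "lin_comb I X (\<lambda>\<omega>. f \<omega> + g \<omega>)" by (rule lin_comb_add[OF f g])
  have "expectation (\<lambda>\<omega>. (f \<omega> + g \<omega>)\<^sup>2)
    = expectation (\<lambda>\<omega>. (f \<omega>)\<^sup>2 + (g \<omega>)\<^sup>2 + 2 * (f \<omega> * g \<omega>))"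
    by (simp add: power2_sum mult.assoc)
  also have "\<dots> = expectation (\<lambda>\<omega>. (f \<omega>)\<^sup>2) + expectation (\<lambda>\<omega>. (g \<omega>)\<^sup>2)"
    using square_lin_comb[OF f] square_lin_comb[OF g] integrable_product_lin_comb[OF f g] assms(3)
    by simp
  finally have "expectation (\<lambda>\<omega>. (f \<omega> + g \<omega>)\<^sup>2) = expectation (\<lambda>\<omega>. (f \<omega>)\<^sup>2) + expectation (\<lambda>\<omega>. (g \<omega>)\<^sup>2)" .
  then show ?thesis
    unfolding char_lin_comb[OF f] char_lin_comb[OF g] char_lin_comb[OF fg]
    by (simp add: exp_add[symmetric] add_divide_distrib flip: of_real_mult)
qed

text \<open>Orthogonal decomposition of the process along the coordinate \<open>X \<tau>\<close>: subtracting the projections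
  onto the normalised variable \<open>\<xi>\<close> leaves a process uncorrelated with \<open>\<xi>\<close>, and for jointly Gaussian
  variables uncorrelated means independent.\<close>

lemma split_off_coordinate:
  assumes \<tau>: "\<tau> \<in> I" and var: "0 < expectation (\<lambda>\<omega>. (X \<tau> \<omega>)\<^sup>2)"
  defines "\<xi> \<equiv> \<lambda>\<omega>. X \<tau> \<omega> / sqrt (expectation (\<lambda>\<omega>. (X \<tau> \<omega>)\<^sup>2))"
  defines "Z \<equiv> \<lambda>t \<omega>. X t \<omega> - expectation (\<lambda>\<omega>. X t \<omega> * \<xi> \<omega>) * \<xi> \<omega>"
  shows "distr M borel \<xi> = std_normal_distribution"
    and "sets (process_algebra M I Z) \<subseteq> sets M"
    and "distr M (borel \<Otimes>\<^sub>M process_algebra M I Z) (\<lambda>\<omega>. (\<xi> \<omega>, \<omega>))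
      = std_normal_distribution \<Otimes>\<^sub>M distr M (process_algebra M I Z) (\<lambda>\<omega>. \<omega>)"
proof -
  let ?v = "expectation (\<lambda>\<omega>. (X \<tau> \<omega>)\<^sup>2)"
  let ?h = "\<lambda>t. expectation (\<lambda>\<omega>. X t \<omega> * \<xi> \<omega>)"
  have \<xi>: "lin_comb I X \<xi>"
    using lin_comb_scale[OF lin_comb_single[OF \<tau>], of X "1 / sqrt ?v"] by (simp add: \<xi>_def)
  have \<xi>2: "expectation (\<lambda>\<omega>. (\<xi> \<omega>)\<^sup>2) = 1"
    using var unfolding \<xi>_def by (simp add: power_divide)
  show law: "distr M borel \<xi> = std_normal_distribution"
  proof -
    have "distr std_normal_distribution borel (\<lambda>x. x) = std_normal_distribution"
      by (rule distr_id2) simp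
    then show ?thesis using law_lin_comb[OF \<xi>] by (simp add: \<xi>2)
  qed
  have Z: "lin_comb I X (Z t)" if "t \<in> I" for t
    using lin_comb_add[OF lin_comb_single[OF that] lin_comb_scale[OF \<xi>, of "- ?h t"]]
    by (simp add: Z_def)
  have uncorrelated: "integrable M (\<lambda>\<omega>. \<xi> \<omega> * Z t \<omega>)" "expectation (\<lambda>\<omega>. \<xi> \<omega> * Z t \<omega>) = 0"
    if "t \<in> I" for t
  proof -
    show "integrable M (\<lambda>\<omega>. \<xi> \<omega> * Z t \<omega>)" by (rule integrable_product_lin_comb[OF \<xi> Z[OF that]])
    have "expectation (\<lambda>\<omega>. \<xi> \<omega> * Z t \<omega>) = expectation (\<lambda>\<omega>. X t \<omega> * \<xi> \<omega> - ?h t * (\<xi> \<omega>)\<^sup>2)"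
      unfolding Z_def by (simp add: algebra_simps power2_eq_square)
    also have "\<dots> = 0"
      using integrable_product_lin_comb[OF lin_comb_single[OF that] \<xi>] square_lin_comb[OF \<xi>]
      by (simp add: \<xi>2)
    finally show "expectation (\<lambda>\<omega>. \<xi> \<omega> * Z t \<omega>) = 0" .
  qed
  have char: "expectation (\<lambda>\<omega>. iexp (v * \<xi> \<omega> + (\<Sum>t\<in>J. c t * Z t \<omega>)))
      = expectation (\<lambda>\<omega>. iexp (v * \<xi> \<omega>)) * expectation (\<lambda>\<omega>. iexp (\<Sum>t\<in>J. c t * Z t \<omega>))"
    if J: "finite J" "J \<subseteq> I" for v J c
  proof (rule char_uncorrelated)
    show "lin_comb I X (\<lambda>\<omega>. v * \<xi> \<omega>)" by (rule lin_comb_scale[OF \<xi>])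
    show "lin_comb I X (\<lambda>\<omega>. \<Sum>t\<in>J. c t * Z t \<omega>)"
      using J by (intro lin_comb_sum lin_comb_scale Z) auto
    have "expectation (\<lambda>\<omega>. v * \<xi> \<omega> * (\<Sum>t\<in>J. c t * Z t \<omega>))
      = expectation (\<lambda>\<omega>. \<Sum>t\<in>J. (v * c t) * (\<xi> \<omega> * Z t \<omega>))"
      by (simp add: sum_distrib_left ac_simps)
    also have "\<dots> = (\<Sum>t\<in>J. (v * c t) * expectation (\<lambda>\<omega>. \<xi> \<omega> * Z t \<omega>))"
      using J uncorrelated(1) by (subst Bochner_Integration.integral_sum) auto
    also have "\<dots> = 0"
      using J uncorrelated(2) by (intro sum.neutral) auto
    finally show "expectation (\<lambda>\<omega>. v * \<xi> \<omega> * (\<Sum>t\<in>J. c t * Z t \<omega>)) = 0" .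
  qed
  note pl = product_law_process_algebra[OF measurable_lin_comb[OF \<xi>] measurable_lin_comb[OF Z] char]
  show "sets (process_algebra M I Z) \<subseteq> sets M" by (rule pl(1))
  show "distr M (borel \<Otimes>\<^sub>M process_algebra M I Z) (\<lambda>\<omega>. (\<xi> \<omega>, \<omega>))
      = std_normal_distribution \<Otimes>\<^sub>M distr M (process_algebra M I Z) (\<lambda>\<omega>. \<omega>)"
    using pl(2) by (simp add: law)
qed

end


section \<open>Convex increasing functions of a Gaussian variable\<close>

text \<open>Since \<open>- \<phi>\<close> is a primitive of \<open>x \<phi>(x)\<close>, the mass of \<open>\<bar>x\<bar> \<phi>(x)\<close> on the half-line below \<open>- \<bar>y\<bar>\<close> is
  exactly \<open>\<phi>(y)\<close>.\<close>

lemma std_normal_density_le_tail: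
  "ennreal (std_normal_density y)
    \<le> (\<integral>\<^sup>+x. ennreal (\<bar>x\<bar> * std_normal_density x) * indicator {..y} x \<partial>lborel)"
proof -
  let ?g = "\<lambda>x. ennreal (\<bar>x\<bar> * std_normal_density x)"
  have lim: "((\<lambda>x. - std_normal_density x) \<longlongrightarrow> - 0) at_top"
  proof (rule tendsto_minus)
    have half: "filterlim (\<lambda>x::real. x\<^sup>2 / 2) at_top at_top"
      using filterlim_tendsto_pos_mult_at_top[OF tendsto_const[of "1 / 2 :: real"] _
          filterlim_pow_at_top[OF _ filterlim_ident, of 2]] by simp
    have "((\<lambda>x::real. (1 / sqrt (2 * pi)) * exp (- x\<^sup>2 / 2)) \<longlongrightarrow> (1 / sqrt (2 * pi)) * 0) at_top"
      by (intro tendsto_mult tendsto_const filterlim_compose[OF exp_at_bot])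
         (use half in \<open>simp add: filterlim_uminus_at_bot\<close>)
    then show "(std_normal_density \<longlongrightarrow> 0) at_top"
      by (simp add: std_normal_density_def[abs_def])
  qed
  have ftc: "(\<integral>\<^sup>+x. ennreal (x * std_normal_density x) * indicator {\<bar>y\<bar>..} x \<partial>lborel)
      = ennreal (- 0 - - std_normal_density \<bar>y\<bar>)"
  proof (rule nn_integral_FTC_atLeast[OF _ _ _ lim])
    fix x assume "\<bar>y\<bar> \<le> x"
    show "((\<lambda>x. - std_normal_density x) has_real_derivative x * std_normal_density x) (at x)"
    proof -
      have "((\<lambda>x. - (c * exp (- x\<^sup>2 / 2))) has_real_derivative x * (c * exp (- x\<^sup>2 / 2))) (at x)" for c :: real
        by (auto intro!: derivative_eq_intros)
      then show ?thesis unfolding std_normal_density_def .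
    qed
    show "0 \<le> x * std_normal_density x" using \<open>\<bar>y\<bar> \<le> x\<close> by simp
  qed simp
  have "ennreal (std_normal_density y)
    = (\<integral>\<^sup>+x. ennreal (x * std_normal_density x) * indicator {\<bar>y\<bar>..} x \<partial>lborel)"
    unfolding ftc by (simp add: std_normal_density_def)
  also have "(\<integral>\<^sup>+x. ennreal (x * std_normal_density x) * indicator {\<bar>y\<bar>..} x \<partial>lborel)
    = (\<integral>\<^sup>+x. ?g x * indicator {\<bar>y\<bar>..} x \<partial>lborel)"
    by (intro nn_integral_cong) (auto split: split_indicator)
  also have "\<dots> = (\<integral>\<^sup>+x. ?g x * indicator {.. - \<bar>y\<bar>} x \<partial>lborel)"
    by (subst nn_integral_real_affine[where c="-1" and t=0])
       (auto intro!: nn_integral_cong split: split_indicator simp: std_normal_density_def)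
  also have "\<dots> \<le> (\<integral>\<^sup>+x. ?g x * indicator {..y} x \<partial>lborel)"
    by (intro nn_integral_mono) (auto split: split_indicator)
  finally show ?thesis .
qed

text \<open>Above \<open>x\<close> a convex function stretches lengths by a factor of at least \<open>f' x\<close>. The substitution rule
  applies on the intervals \<open>[x, x + n]\<close>, and \<open>n\<close> tends to infinity.\<close>

lemma convex_expands_above:
  fixes f f' :: "real \<Rightarrow> real"
  assumes f: "\<And>x. (f has_real_derivative f' x) (at x)"
    and cont: "continuous_on UNIV f'" and pos: "\<And>x. 0 < f' x" and mono: "mono f'"
    and A [measurable]: "A \<in> sets borel"
  shows "ennreal (f' x) * (\<integral>\<^sup>+y. indicator A (f y) * indicator {x..} y \<partial>lborel)
    \<le> (\<integral>\<^sup>+z. indicator A z * indicator {f x..} z \<partial>lborel)"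
proof -
  have fcont: "continuous_on UNIV f"
    using f by (meson DERIV_continuous_on has_field_derivative_at_within)
  then have [measurable]: "f \<in> borel_measurable borel"
    by (rule borel_measurable_continuous_onI)
  let ?h = "\<lambda>n y. indicator A (f y) * indicator {x..x + real n} y :: ennreal"
  have bound: "ennreal (f' x) * (\<integral>\<^sup>+y. ?h n y \<partial>lborel) \<le> (\<integral>\<^sup>+z. indicator A z * indicator {f x..} z \<partial>lborel)" for n
  proof -
    have "ennreal (f' x) * (\<integral>\<^sup>+y. ?h n y \<partial>lborel) = (\<integral>\<^sup>+y. ennreal (f' x) * ?h n y \<partial>lborel)"
      by (subst nn_integral_cmult) auto
    also have "\<dots> \<le> (\<integral>\<^sup>+y. ennreal (indicator A (f y) * f' y * indicator {x..x + real n} y) \<partial>lborel)"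
      using monoD[OF mono] by (intro nn_integral_mono) (auto split: split_indicator intro!: ennreal_leI)
    also have "\<dots> = (\<integral>\<^sup>+z. ennreal (indicator A z * indicator {f x..f (x + real n)} z) \<partial>lborel)"
      by (subst nn_integral_substitution[where g=f and g'=f'])
         (use f cont pos in \<open>auto simp: set_borel_measurable_def less_imp_le intro: continuous_on_subset\<close>)
    also have "\<dots> \<le> (\<integral>\<^sup>+z. indicator A z * indicator {f x..} z \<partial>lborel)"
      by (intro nn_integral_mono) (auto split: split_indicator)
    finally show ?thesis .
  qed
  have "(\<integral>\<^sup>+y. indicator A (f y) * indicator {x..} y \<partial>lborel) = (\<integral>\<^sup>+y. (SUP n. ?h n y) \<partial>lborel)"
  proof (intro nn_integral_cong)
    fix y :: real
    obtain n :: nat where n: "y - x \<le> real n" using real_arch_simple by blast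
    show "indicator A (f y) * indicator {x..} y = (SUP n. ?h n y)"
      by (rule antisym, rule SUP_upper2[of n], use n in \<open>auto split: split_indicator intro!: SUP_least\<close>)
  qed
  also have "\<dots> = (SUP n. \<integral>\<^sup>+y. ?h n y \<partial>lborel)"
    by (rule nn_integral_monotone_convergence_SUP)
       (auto simp: incseq_def le_fun_def split: split_indicator)
  finally have "ennreal (f' x) * (\<integral>\<^sup>+y. indicator A (f y) * indicator {x..} y \<partial>lborel)
    = (SUP n. ennreal (f' x) * (\<integral>\<^sup>+y. ?h n y \<partial>lborel))"
    by (simp add: SUP_mult_left_ennreal)
  also have "\<dots> \<le> (\<integral>\<^sup>+z. indicator A z * indicator {f x..} z \<partial>lborel)"
    using bound by (intro SUP_least) auto
  finally show ?thesis .
qed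

text \<open>The inner integral on the right is a bound for the density of \<open>f\<close> under the normal law at \<open>z\<close>. It
  arises by replacing \<open>\<phi>(y)\<close> with the integral of \<open>\<bar>x\<bar> \<phi>(x)\<close> over \<open>x \<le> y\<close>, exchanging the integrals, and
  using that \<open>f\<close> stretches the half-line above \<open>x\<close> by at least \<open>f' x\<close>.\<close>

lemma gaussian_image_le_density:
  fixes f f' :: "real \<Rightarrow> real"
  assumes f: "\<And>x. (f has_real_derivative f' x) (at x)"
    and cont: "continuous_on UNIV f'" and pos: "\<And>x. 0 < f' x" and mono: "mono f'"
    and A [measurable]: "A \<in> sets borel"
  shows "(\<integral>\<^sup>+x. indicator A (f x) \<partial>std_normal_distribution)
    \<le> (\<integral>\<^sup>+z. indicator A z * (\<integral>\<^sup>+x. ennreal (\<bar>x\<bar> / f' x) * indicator {f x..} z \<partial>std_normal_distribution) \<partial>lborel)"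
proof -
  have fcont: "continuous_on UNIV f"
    using f by (meson DERIV_continuous_on has_field_derivative_at_within)
  then have [measurable]: "f \<in> borel_measurable borel"
    by (rule borel_measurable_continuous_onI)
  from cont have [measurable]: "f' \<in> borel_measurable borel"
    by (rule borel_measurable_continuous_onI)
  let ?p = "std_normal_density"
  have ind: "indicator {f x..} z = (indicator {z. f (fst z) \<le> snd z} (x, z) :: ennreal)" for x z
    by (simp split: split_indicator)
  have ind2: "indicator {x..} y = (indicator {z. fst z \<le> snd z} (x, y) :: ennreal)" for x y :: real
    by (simp split: split_indicator)
  have ind3: "indicator {..y} x = (indicator {x..} y :: ennreal)" for x y :: real
    by (simp split: split_indicator)
  have "(\<integral>\<^sup>+x. indicator A (f x) \<partial>std_normal_distribution) = (\<integral>\<^sup>+y. ennreal (?p y) * indicator A (f y) \<partial>lborel)"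
    by (subst nn_integral_density) auto
  also have "\<dots> \<le> (\<integral>\<^sup>+y. (\<integral>\<^sup>+x. ennreal (\<bar>x\<bar> * ?p x) * indicator {..y} x \<partial>lborel) * indicator A (f y) \<partial>lborel)"
    by (intro nn_integral_mono mult_right_mono std_normal_density_le_tail) auto
  also have "\<dots> = (\<integral>\<^sup>+y. (\<integral>\<^sup>+x. ennreal (\<bar>x\<bar> * ?p x) * (indicator A (f y) * indicator {x..} y) \<partial>lborel) \<partial>lborel)"
    by (intro nn_integral_cong, subst nn_integral_multc[symmetric]) (auto simp: ind2 ind3 ac_simps)
  also have "\<dots> = (\<integral>\<^sup>+x. (\<integral>\<^sup>+y. ennreal (\<bar>x\<bar> * ?p x) * (indicator A (f y) * indicator {x..} y) \<partial>lborel) \<partial>lborel)"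
    unfolding ind2 by (rule lborel_pair.Fubini') measurable
  also have "\<dots> = (\<integral>\<^sup>+x. ennreal (\<bar>x\<bar> * ?p x) * (\<integral>\<^sup>+y. indicator A (f y) * indicator {x..} y \<partial>lborel) \<partial>lborel)"
    by (intro nn_integral_cong nn_integral_cmult) auto
  also have "\<dots> = (\<integral>\<^sup>+x. ennreal (?p x * (\<bar>x\<bar> / f' x)) *
      (ennreal (f' x) * (\<integral>\<^sup>+y. indicator A (f y) * indicator {x..} y \<partial>lborel)) \<partial>lborel)"
  proof (intro nn_integral_cong)
    fix x
    have "ennreal (\<bar>x\<bar> * ?p x) = ennreal (?p x * (\<bar>x\<bar> / f' x)) * ennreal (f' x)"
      using pos[of x] by (subst ennreal_mult[symmetric]) (auto simp: less_imp_le)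
    then show "ennreal (\<bar>x\<bar> * ?p x) * (\<integral>\<^sup>+y. indicator A (f y) * indicator {x..} y \<partial>lborel)
      = ennreal (?p x * (\<bar>x\<bar> / f' x)) *
      (ennreal (f' x) * (\<integral>\<^sup>+y. indicator A (f y) * indicator {x..} y \<partial>lborel))"
      by (simp only: mult.assoc)
  qed
  also have "\<dots> \<le> (\<integral>\<^sup>+x. ennreal (?p x * (\<bar>x\<bar> / f' x)) * (\<integral>\<^sup>+z. indicator A z * indicator {f x..} z \<partial>lborel) \<partial>lborel)"
    by (intro nn_integral_mono mult_left_mono convex_expands_above[OF f cont pos mono A]) auto
  also have "\<dots> = (\<integral>\<^sup>+x. (\<integral>\<^sup>+z. ennreal (?p x * (\<bar>x\<bar> / f' x)) * (indicator A z * indicator {f x..} z) \<partial>lborel) \<partial>lborel)"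
    by (intro nn_integral_cong nn_integral_cmult[symmetric]) auto
  also have "\<dots> = (\<integral>\<^sup>+z. (\<integral>\<^sup>+x. ennreal (?p x * (\<bar>x\<bar> / f' x)) * (indicator A z * indicator {f x..} z) \<partial>lborel) \<partial>lborel)"
    unfolding ind by (rule lborel_pair.Fubini'[symmetric]) measurable
  also have "\<dots> = (\<integral>\<^sup>+z. indicator A z * (\<integral>\<^sup>+x. ennreal (?p x * (\<bar>x\<bar> / f' x)) * indicator {f x..} z \<partial>lborel) \<partial>lborel)"
    unfolding ind by (intro nn_integral_cong, subst nn_integral_cmult[symmetric]) (auto simp: ac_simps)
  also have "\<dots> = (\<integral>\<^sup>+z. indicator A z * (\<integral>\<^sup>+x. ennreal (\<bar>x\<bar> / f' x) * indicator {f x..} z \<partial>std_normal_distribution) \<partial>lborel)"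
  proof (intro nn_integral_cong arg_cong2[where f="(*)"] refl)
    fix z
    show "(\<integral>\<^sup>+x. ennreal (?p x * (\<bar>x\<bar> / f' x)) * indicator {f x..} z \<partial>lborel)
      = (\<integral>\<^sup>+x. ennreal (\<bar>x\<bar> / f' x) * indicator {f x..} z \<partial>std_normal_distribution)"
      unfolding ind using pos
      by (subst nn_integral_density)
         (auto intro!: nn_integral_cong simp: ennreal_mult' less_imp_le mult.assoc
           simp flip: times_divide_eq_right)
  qed
  finally show ?thesis .
qed

text \<open>The one-dimensional bound is applied in the Gaussian coordinate with \<open>\<omega>\<close> frozen, and then averaged;
  the product law makes it legitimate to recombine the two arguments afterwards.\<close>

lemma (in prob_space) law_bound_by_gaussian_coordinate:
  fixes \<xi> :: "'a \<Rightarrow> real" and f f' :: "real \<times> 'a \<Rightarrow> real"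
  assumes sub: "sets N \<subseteq> sets M" "space N = space M"
    and \<xi> [measurable]: "\<xi> \<in> borel_measurable M"
    and law: "distr M (borel \<Otimes>\<^sub>M N) (\<lambda>\<omega>. (\<xi> \<omega>, \<omega>)) = std_normal_distribution \<Otimes>\<^sub>M distr M N (\<lambda>\<omega>. \<omega>)"
    and f [measurable]: "f \<in> borel_measurable (borel \<Otimes>\<^sub>M N)"
    and f' [measurable]: "f' \<in> borel_measurable (borel \<Otimes>\<^sub>M N)"
    and deriv: "\<And>\<omega> x. \<omega> \<in> space M \<Longrightarrow> ((\<lambda>x. f (x, \<omega>)) has_real_derivative f' (x, \<omega>)) (at x)"
    and cont: "\<And>\<omega>. \<omega> \<in> space M \<Longrightarrow> continuous_on UNIV (\<lambda>x. f' (x, \<omega>))"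
    and pos: "\<And>\<omega> x. \<omega> \<in> space M \<Longrightarrow> 0 < f' (x, \<omega>)"
    and mono: "\<And>\<omega>. \<omega> \<in> space M \<Longrightarrow> mono (\<lambda>x. f' (x, \<omega>))"
    and A [measurable]: "A \<in> sets borel"
  shows "emeasure M {\<omega> \<in> space M. f (\<xi> \<omega>, \<omega>) \<in> A} \<le> (\<integral>\<^sup>+z. indicator A z *
    (\<integral>\<^sup>+\<omega>. ennreal (\<bar>\<xi> \<omega>\<bar> / f' (\<xi> \<omega>, \<omega>)) * indicator {f (\<xi> \<omega>, \<omega>)..} z \<partial>M) \<partial>lborel)"
proof -
  have id [measurable]: "(\<lambda>\<omega>. \<omega>) \<in> measurable M N"
    by (rule measurableI) (use sub in auto)
  have pair [measurable]: "(\<lambda>\<omega>. (\<xi> \<omega>, \<omega>)) \<in> measurable M (borel \<Otimes>\<^sub>M N)"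
    by measurable
  define Q where "Q = distr M N (\<lambda>\<omega>. \<omega>)"
  have [measurable_cong, simp]: "sets Q = sets N" and spQ: "space Q = space M"
    by (simp_all add: Q_def sub)
  interpret S: real_distribution std_normal_distribution by (rule real_dist_normal_dist)
  interpret Q: prob_space Q unfolding Q_def by (rule prob_space_distr) simp
  interpret P: pair_sigma_finite std_normal_distribution Q ..
  interpret L: pair_sigma_finite Q "lborel :: real measure" ..
  have transfer: "(\<integral>\<^sup>+\<omega>. u (\<xi> \<omega>, \<omega>) \<partial>M) = (\<integral>\<^sup>+\<omega>. (\<integral>\<^sup>+x. u (x, \<omega>) \<partial>std_normal_distribution) \<partial>Q)"
    if [measurable]: "u \<in> borel_measurable (borel \<Otimes>\<^sub>M N)" for u
  proof -
    have "(\<integral>\<^sup>+\<omega>. u (\<xi> \<omega>, \<omega>) \<partial>M) = (\<integral>\<^sup>+z. u z \<partial>distr M (borel \<Otimes>\<^sub>M N) (\<lambda>\<omega>. (\<xi> \<omega>, \<omega>)))"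
      by (simp add: nn_integral_distr)
    also have "\<dots> = (\<integral>\<^sup>+z. u z \<partial>(std_normal_distribution \<Otimes>\<^sub>M Q))"
      by (simp add: law Q_def)
    also have "\<dots> = (\<integral>\<^sup>+\<omega>. (\<integral>\<^sup>+x. u (x, \<omega>) \<partial>std_normal_distribution) \<partial>Q)"
      by (rule P.nn_integral_snd[symmetric]) measurable
    finally show ?thesis .
  qed
  have ind: "indicator {f y..} z = (indicator {w. f (fst w) \<le> snd w} (y, z) :: ennreal)" for y z
    by (simp split: split_indicator)
  have "emeasure M {\<omega> \<in> space M. f (\<xi> \<omega>, \<omega>) \<in> A} = (\<integral>\<^sup>+\<omega>. indicator A (f (\<xi> \<omega>, \<omega>)) \<partial>M)"
  proof -
    have "{\<omega> \<in> space M. f (\<xi> \<omega>, \<omega>) \<in> A} \<in> events" by measurable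
    then have "emeasure M {\<omega> \<in> space M. f (\<xi> \<omega>, \<omega>) \<in> A}
      = (\<integral>\<^sup>+\<omega>. indicator {\<omega> \<in> space M. f (\<xi> \<omega>, \<omega>) \<in> A} \<omega> \<partial>M)"
      by simp
    also have "\<dots> = (\<integral>\<^sup>+\<omega>. indicator A (f (\<xi> \<omega>, \<omega>)) \<partial>M)"
      by (intro nn_integral_cong) (simp split: split_indicator)
    finally show ?thesis .
  qed
  also have "\<dots> = (\<integral>\<^sup>+\<omega>. (\<integral>\<^sup>+x. indicator A (f (x, \<omega>)) \<partial>std_normal_distribution) \<partial>Q)"
    by (rule transfer) measurable
  also have "\<dots> \<le> (\<integral>\<^sup>+\<omega>. (\<integral>\<^sup>+z. indicator A z * (\<integral>\<^sup>+x. ennreal (\<bar>x\<bar> / f' (x, \<omega>)) *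
      indicator {f (x, \<omega>)..} z \<partial>std_normal_distribution) \<partial>lborel) \<partial>Q)"
    by (intro nn_integral_mono gaussian_image_le_density) (auto simp: spQ deriv cont pos mono)
  also have "\<dots> = (\<integral>\<^sup>+z. (\<integral>\<^sup>+\<omega>. indicator A z * (\<integral>\<^sup>+x. ennreal (\<bar>x\<bar> / f' (x, \<omega>)) *
      indicator {f (x, \<omega>)..} z \<partial>std_normal_distribution) \<partial>Q) \<partial>lborel)"
    unfolding ind by (rule L.Fubini'[symmetric]) measurable
  also have "\<dots> = (\<integral>\<^sup>+z. indicator A z * (\<integral>\<^sup>+\<omega>. (\<integral>\<^sup>+x. ennreal (\<bar>x\<bar> / f' (x, \<omega>)) *
      indicator {f (x, \<omega>)..} z \<partial>std_normal_distribution) \<partial>Q) \<partial>lborel)"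
    unfolding ind by (intro nn_integral_cong nn_integral_cmult) measurable
  also have "\<dots> = (\<integral>\<^sup>+z. indicator A z * (\<integral>\<^sup>+\<omega>. ennreal (\<bar>\<xi> \<omega>\<bar> / f' (\<xi> \<omega>, \<omega>)) *
      indicator {f (\<xi> \<omega>, \<omega>)..} z \<partial>M) \<partial>lborel)"
  proof (intro nn_integral_cong arg_cong2[where f="(*)"] refl)
    fix z
    have "(\<lambda>y. ennreal (\<bar>fst y\<bar> / f' y) * indicator {f y..} z) \<in> borel_measurable (borel \<Otimes>\<^sub>M N)"
      unfolding ind by measurable
    from transfer[OF this]
    show "(\<integral>\<^sup>+\<omega>. (\<integral>\<^sup>+x. ennreal (\<bar>x\<bar> / f' (x, \<omega>)) * indicator {f (x, \<omega>)..} z \<partial>std_normal_distribution) \<partial>Q)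
      = (\<integral>\<^sup>+\<omega>. ennreal (\<bar>\<xi> \<omega>\<bar> / f' (\<xi> \<omega>, \<omega>)) * indicator {f (\<xi> \<omega>, \<omega>)..} z \<partial>M)"
      by simp
  qed
  finally show ?thesis .
qed

section \<open>Integrals of exponentials over an interval\<close>

definition exp_integral :: "real \<Rightarrow> (real \<Rightarrow> real) \<Rightarrow> (real \<Rightarrow> real) \<Rightarrow> real" where
  "exp_integral T k g = (LBINT s:{0..T}. k s * exp (g s))"

lemma exp_integral_eq_integral:
  assumes "continuous_on {0..T} k" "continuous_on {0..T} g"
  shows "exp_integral T k g = integral {0..T} (\<lambda>s. k s * exp (g s))"
  unfolding exp_integral_def
  by (intro set_borel_integral_eq_integral borel_integrable_atLeastAtMost' continuous_intros assms)

lemma exp_integral_pos: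
  assumes "0 < T" "continuous_on {0..T} k" "continuous_on {0..T} g"
    and nonneg: "\<And>s. s \<in> {0..T} \<Longrightarrow> 0 \<le> k s" and pos: "r \<in> {0..T}" "0 < k r"
  shows "0 < exp_integral T k g"
proof -
  have c: "continuous_on {0..T} (\<lambda>s. k s * exp (g s))"
    by (intro continuous_intros assms)
  have "integral {0..T} (\<lambda>s. k s * exp (g s)) \<noteq> 0"
    using integral_eq_0_iff[OF c \<open>0 < T\<close>] nonneg pos by force
  moreover have "0 \<le> integral {0..T} (\<lambda>s. k s * exp (g s))"
    by (intro integral_nonneg integrable_continuous_real c) (simp add: nonneg)
  ultimately show ?thesis
    using assms by (simp add: exp_integral_eq_integral)
qed

lemma exp_integral_shift_derivative:
  assumes k: "continuous_on {0..T} k" and g: "continuous_on {0..T} g" and h: "continuous_on {0..T} h"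
  shows "((\<lambda>x. exp_integral T k (\<lambda>s. g s + x * h s)) has_real_derivative
      exp_integral T (\<lambda>s. h s * k s) (\<lambda>s. g s + x * h s)) (at x)"
    and "continuous_on UNIV (\<lambda>x. exp_integral T k (\<lambda>s. g s + x * h s))"
proof -
  note [continuous_intros] = continuous_on_compose2[OF k] continuous_on_compose2[OF g]
    continuous_on_compose2[OF h]
  have eq: "exp_integral T q (\<lambda>s. g s + x * h s) = integral (cbox 0 T) (\<lambda>s. q s * exp (g s + x * h s))"
    if "continuous_on {0..T} q" for x q
    using that by (subst exp_integral_eq_integral) (auto intro!: continuous_intros)
  have hk: "continuous_on {0..T} (\<lambda>s. h s * k s)"
    by (auto intro!: continuous_intros)
  have "((\<lambda>x. integral (cbox 0 T) (\<lambda>s. k s * exp (g s + x * h s))) has_real_derivative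
      integral (cbox 0 T) (\<lambda>s. (h s * k s) * exp (g s + x * h s))) (at x within UNIV)"
  proof (rule leibniz_rule_field_derivative)
    show "(\<lambda>s. k s * exp (g s + x * h s)) integrable_on cbox 0 T" for x
      by (rule integrable_continuous) (auto intro!: continuous_intros)
  qed (auto intro!: derivative_eq_intros continuous_intros simp: split_beta')
  then show "((\<lambda>x. exp_integral T k (\<lambda>s. g s + x * h s)) has_real_derivative
      exp_integral T (\<lambda>s. h s * k s) (\<lambda>s. g s + x * h s)) (at x)"
    by (simp add: eq k hk)
  have "continuous_on UNIV (\<lambda>x. integral (cbox 0 T) (\<lambda>s. k s * exp (g s + x * h s)))"
    by (rule integral_continuous_on_param) (auto intro!: continuous_intros simp: split_beta')
  then show "continuous_on UNIV (\<lambda>x. exp_integral T k (\<lambda>s. g s + x * h s))"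
    by (simp add: eq k)
qed

lemma exp_integral_mono:
  assumes "continuous_on {0..T} k" "continuous_on {0..T} g" "continuous_on {0..T} g'"
    and "\<And>s. s \<in> {0..T} \<Longrightarrow> 0 \<le> k s" "\<And>s. s \<in> {0..T} \<Longrightarrow> k s * exp (g s) \<le> k s * exp (g' s)"
  shows "exp_integral T k g \<le> exp_integral T k g'"
  using assms
  by (auto simp: exp_integral_eq_integral intro!: integral_le integrable_continuous_real continuous_intros)

text \<open>Jensen's inequality for \<open>u \<mapsto> u\<^bsup>-p\<^esup>\<close> and the weight \<open>k\<close> of total mass \<open>K\<close>. With \<open>m\<close> the logarithm of
  the weighted mean of \<open>exp g\<close>, the supporting line at \<open>exp m\<close> follows from
  \<open>exp (- p v) \<ge> 1 - p v \<ge> 1 - p (exp v - 1)\<close> at \<open>v = g s - m\<close>, and integrates to the claim.\<close>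

lemma exp_integral_negative_power:
  assumes T: "0 < T" and k: "continuous_on {0..T} k" and g: "continuous_on {0..T} g"
    and nonneg: "\<And>s. s \<in> {0..T} \<Longrightarrow> 0 \<le> k s" and pos: "r \<in> {0..T}" "0 < k r" and p: "0 \<le> p"
  defines "K \<equiv> exp_integral T k (\<lambda>_. 0)"
  shows "K * (exp_integral T k g / K) powr (- p) \<le> exp_integral T k (\<lambda>s. - p * g s)"
proof -
  have K: "0 < K" unfolding K_def by (rule exp_integral_pos[OF T k _ nonneg pos]) auto
  have W: "0 < exp_integral T k g" by (rule exp_integral_pos[OF T k g nonneg pos])
  define m where "m = ln (exp_integral T k g / K)"
  have em: "exp m = exp_integral T k g / K" unfolding m_def using K W by simp
  have Kint: "K = integral {0..T} k"
    unfolding K_def using k by (simp add: exp_integral_eq_integral)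
  have Wint: "exp_integral T k g = integral {0..T} (\<lambda>s. k s * exp (g s))"
    by (rule exp_integral_eq_integral[OF k g])
  have "exp (- p * m) * K = exp (- p * m) * ((1 + p) * K - p * exp (- m) * exp_integral T k g)"
    using K W by (simp add: exp_minus em field_simps)
  also have "\<dots> = integral {0..T} (\<lambda>s. exp (- p * m) * ((1 + p) * k s - p * exp (- m) * (k s * exp (g s))))"
    unfolding Kint Wint integral_mult_right[symmetric]
    by (subst integral_diff[symmetric])
       (auto intro!: integrable_continuous_real continuous_intros k g simp flip: integral_mult_right)
  also have "\<dots> \<le> integral {0..T} (\<lambda>s. k s * exp (- p * g s))"
  proof (rule integral_le)
    fix s assume s: "s \<in> {0..T}"
    have e: "g s - m \<le> exp (g s - m) - 1"
      using exp_ge_add_one_self[of "g s - m"] by linarith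
    have "(1 + p) - p * (exp (- m) * exp (g s)) = 1 - p * (exp (g s - m) - 1)"
      by (simp add: algebra_simps flip: exp_add)
    also have "\<dots> \<le> 1 - p * (g s - m)"
      using mult_left_mono[OF e p] by simp
    also have "\<dots> \<le> exp (- p * (g s - m))"
      using exp_ge_add_one_self[of "- p * (g s - m)"] by simp
    finally have "exp (- p * m) * ((1 + p) - p * (exp (- m) * exp (g s)))
        \<le> exp (- p * m) * exp (- p * (g s - m))"
      by (rule mult_left_mono) simp
    also have "\<dots> = exp (- p * g s)"
      by (simp add: algebra_simps flip: exp_add)
    finally have "k s * (exp (- p * m) * ((1 + p) - p * (exp (- m) * exp (g s)))) \<le> k s * exp (- p * g s)"
      by (rule mult_left_mono) (rule nonneg[OF s])
    then show "exp (- p * m) * ((1 + p) * k s - p * exp (- m) * (k s * exp (g s))) \<le> k s * exp (- p * g s)"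
      by (simp add: algebra_simps)
  qed (auto intro!: integrable_continuous_real continuous_intros k g)
  also have "\<dots> = exp_integral T k (\<lambda>s. - p * g s)"
    by (subst exp_integral_eq_integral[OF k]) (auto intro!: continuous_intros g)
  also have "exp (- p * m) = (exp_integral T k g / K) powr (- p)"
    unfolding m_def using K W by (simp add: powr_def)
  finally show ?thesis by (simp add: mult.commute)
qed

text \<open>The process is the pointwise limit of its discretisations at times \<open>\<lfloor>n s\<rfloor> / n\<close>, which take only
  countably many times into account. Clamping the time to \<open>[0, T]\<close> extends the process to the line.\<close>

lemma continuous_paths_jointly_measurable:
  fixes Y :: "real \<Rightarrow> 'a \<Rightarrow> real"
  assumes T: "0 \<le> T" and Y: "\<And>s. s \<in> {0..T} \<Longrightarrow> Y s \<in> borel_measurable N"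
    and paths: "\<And>\<omega>. \<omega> \<in> space N \<Longrightarrow> continuous_on {0..T} (\<lambda>s. Y s \<omega> :: real)"
  shows "(\<lambda>z. Y (max 0 (min T (fst z))) (snd z)) \<in> borel_measurable (borel \<Otimes>\<^sub>M N)"
proof (rule borel_measurable_LIMSEQ_real)
  let ?c = "\<lambda>s. max 0 (min T s)"
  have c: "?c s \<in> {0..T}" for s using T by (auto simp: max_def min_def)
  let ?d = "\<lambda>n s. of_int \<lfloor>real (Suc n) * s\<rfloor> / real (Suc n)"
  fix n
  show "(\<lambda>z. Y (?c (?d n (fst z))) (snd z)) \<in> borel_measurable (borel \<Otimes>\<^sub>M N)"
  proof (rule measurable_compose_countable[where f="\<lambda>i z. Y (?c (of_int i / real (Suc n))) (snd z)"
        and g="\<lambda>z. \<lfloor>real (Suc n) * fst z\<rfloor>"])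
    show "(\<lambda>z. Y (?c (of_int i / real (Suc n))) (snd z)) \<in> borel_measurable (borel \<Otimes>\<^sub>M N)" for i
      by (rule measurable_compose[OF measurable_snd Y[OF c]])
    show "(\<lambda>z. \<lfloor>real (Suc n) * fst z\<rfloor>) \<in> borel \<Otimes>\<^sub>M N \<rightarrow>\<^sub>M count_space UNIV"
      by measurable
  qed
next
  let ?c = "\<lambda>s. max 0 (min T s)"
  let ?d = "\<lambda>n s. of_int \<lfloor>real (Suc n) * s\<rfloor> / real (Suc n)"
  fix z :: "real \<times> 'a" assume "z \<in> space (borel \<Otimes>\<^sub>M N)"
  then have \<omega>: "snd z \<in> space N" by (auto simp: space_pair_measure)
  have d: "(\<lambda>n. ?d n (fst z)) \<longlonglongrightarrow> fst z"
  proof (rule tendsto_sandwich)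
    show "\<forall>\<^sub>F n in sequentially. fst z - 1 / real (Suc n) \<le> ?d n (fst z)"
    proof (intro always_eventually allI)
      fix n
      have "real (Suc n) * fst z - 1 \<le> of_int \<lfloor>real (Suc n) * fst z\<rfloor>" by linarith
      from divide_right_mono[OF this, of "real (Suc n)"]
      show "fst z - 1 / real (Suc n) \<le> ?d n (fst z)"
        by (simp add: diff_divide_distrib del: of_nat_Suc)
    qed
    show "\<forall>\<^sub>F n in sequentially. ?d n (fst z) \<le> fst z"
    proof (intro always_eventually allI)
      fix n
      have "of_int \<lfloor>real (Suc n) * fst z\<rfloor> \<le> real (Suc n) * fst z" by linarith
      from divide_right_mono[OF this, of "real (Suc n)"]
      show "?d n (fst z) \<le> fst z"
        by (simp del: of_nat_Suc)
    qed
    show "(\<lambda>n. fst z - 1 / real (Suc n)) \<longlonglongrightarrow> fst z"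
      using tendsto_diff[OF tendsto_const LIMSEQ_inverse_real_of_nat, of "fst z"]
      by (simp add: inverse_eq_divide)
  qed auto
  have "(\<lambda>n. ?c (?d n (fst z))) \<longlonglongrightarrow> ?c (fst z)"
    by (intro tendsto_max tendsto_min tendsto_const d)
  then show "(\<lambda>n. Y (?c (?d n (fst z))) (snd z)) \<longlonglongrightarrow> Y (?c (fst z)) (snd z)"
    by (rule continuous_on_tendsto_compose[OF paths[OF \<omega>]]) (use T in \<open>auto intro!: always_eventually\<close>)
qed

lemma exp_integral_measurable:
  assumes T: "0 \<le> T" and k: "continuous_on {0..T} k"
    and Y: "\<And>s. s \<in> {0..T} \<Longrightarrow> Y s \<in> borel_measurable N"
    and paths: "\<And>\<omega>. \<omega> \<in> space N \<Longrightarrow> continuous_on {0..T} (\<lambda>s. Y s \<omega>)"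
  shows "(\<lambda>\<omega>. exp_integral T k (\<lambda>s. Y s \<omega>)) \<in> borel_measurable N"
proof -
  note j [measurable] = continuous_paths_jointly_measurable[OF T Y paths]
  have k' [measurable]: "(\<lambda>s. indicator {0..T} s * k s) \<in> borel_measurable borel"
    using borel_measurable_continuous_on_indicator[OF _ k] by simp
  have [measurable]: "(\<lambda>z. Y (max 0 (min T (snd z))) (fst z)) \<in> borel_measurable (N \<Otimes>\<^sub>M borel)"
    using measurable_compose[OF measurable_pair_swap' j] by (simp add: split_beta')
  have "(\<lambda>\<omega>. LINT s|lborel. (indicator {0..T} s * k s) * exp (Y (max 0 (min T s)) \<omega>)) \<in> borel_measurable N"
    by measurable
  also have "(\<lambda>\<omega>. LINT s|lborel. (indicator {0..T} s * k s) * exp (Y (max 0 (min T s)) \<omega>))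
    = (\<lambda>\<omega>. exp_integral T k (\<lambda>s. Y s \<omega>))"
    unfolding exp_integral_def set_lebesgue_integral_def
    by (intro ext Bochner_Integration.integral_cong) (auto split: split_indicator)
  finally show ?thesis .
qed

text \<open>Jensen's inequality pathwise, followed by an exchange of expectation and time integral: only the
  one-dimensional exponential moments of the process enter.\<close>

lemma exp_integral_negative_moment:
  fixes C :: ennreal
  assumes "prob_space M" and T: "0 < T" and k: "continuous_on {0..T} k"
    and nonneg: "\<And>s. s \<in> {0..T} \<Longrightarrow> 0 \<le> k s" and pos: "r \<in> {0..T}" "0 < k r" and p: "0 \<le> p"
    and Y: "\<And>s. s \<in> {0..T} \<Longrightarrow> Y s \<in> borel_measurable M"
    and paths: "\<And>\<omega>. \<omega> \<in> space M \<Longrightarrow> continuous_on {0..T} (\<lambda>s. Y s \<omega>)"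
    and moment: "\<And>s. s \<in> {0..T} \<Longrightarrow> (\<integral>\<^sup>+\<omega>. ennreal (exp (- p * Y s \<omega>)) \<partial>M) \<le> C"
  shows "(\<integral>\<^sup>+\<omega>. ennreal ((exp_integral T k (\<lambda>s. Y s \<omega>) / exp_integral T k (\<lambda>_. 0)) powr (- p)) \<partial>M) \<le> C"
proof -
  interpret prob_space M by fact
  let ?K = "exp_integral T k (\<lambda>_. 0)"
  let ?W = "\<lambda>\<omega>. exp_integral T k (\<lambda>s. Y s \<omega>)"
  have K: "0 < ?K" by (rule exp_integral_pos[OF T k _ nonneg pos]) auto
  have T0: "0 \<le> T" using T by simp
  note [measurable] = exp_integral_measurable[OF T0 k Y paths]
  note j [measurable] = continuous_paths_jointly_measurable[OF T0 Y paths]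
  have k' [measurable]: "(\<lambda>s. indicator {0..T} s * k s) \<in> borel_measurable borel"
    using borel_measurable_continuous_on_indicator[OF _ k] by simp
  have swap [measurable]: "(\<lambda>z. Y (max 0 (min T (snd z))) (fst z)) \<in> borel_measurable (M \<Otimes>\<^sub>M borel)"
    using measurable_compose[OF measurable_pair_swap' j] by (simp add: split_beta')
  interpret pair_sigma_finite M lborel ..
  have nn: "ennreal (exp_integral T k g) = (\<integral>\<^sup>+s. ennreal (indicator {0..T} s * k s) * ennreal (exp (g s)) \<partial>lborel)"
    if g: "continuous_on {0..T} g" for g
  proof -
    have i: "set_integrable lborel {0..T} (\<lambda>s. k s * exp (g s))"
      by (intro borel_integrable_atLeastAtMost' continuous_intros k g)
    have "ennreal (exp_integral T k g) = (\<integral>\<^sup>+s. ennreal (indicator {0..T} s *\<^sub>R (k s * exp (g s))) \<partial>lborel)"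
      using i unfolding exp_integral_def set_lebesgue_integral_def set_integrable_def
      by (subst nn_integral_eq_integral) (auto simp: nonneg indicator_def)
    also have "\<dots> = (\<integral>\<^sup>+s. ennreal (indicator {0..T} s * k s) * ennreal (exp (g s)) \<partial>lborel)"
      by (intro nn_integral_cong) (auto simp: nonneg ennreal_mult' split: split_indicator)
    finally show ?thesis .
  qed
  have "ennreal ?K * (\<integral>\<^sup>+\<omega>. ennreal ((?W \<omega> / ?K) powr (- p)) \<partial>M)
    = (\<integral>\<^sup>+\<omega>. ennreal (?K * (?W \<omega> / ?K) powr (- p)) \<partial>M)"
    using K by (subst nn_integral_cmult[symmetric]) (auto simp: ennreal_mult')
  also have "\<dots> \<le> (\<integral>\<^sup>+\<omega>. ennreal (exp_integral T k (\<lambda>s. - p * Y s \<omega>)) \<partial>M)"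
    by (intro nn_integral_mono ennreal_leI exp_integral_negative_power[OF T k paths nonneg pos p])
  also have "\<dots> = (\<integral>\<^sup>+\<omega>. (\<integral>\<^sup>+s. ennreal (indicator {0..T} s * k s) *
      ennreal (exp (- p * Y (max 0 (min T s)) \<omega>)) \<partial>lborel) \<partial>M)"
  proof (intro nn_integral_cong)
    fix \<omega> assume "\<omega> \<in> space M"
    then have c: "continuous_on {0..T} (\<lambda>s. - p * Y s \<omega>)"
      by (intro continuous_intros paths)
    show "ennreal (exp_integral T k (\<lambda>s. - p * Y s \<omega>)) = (\<integral>\<^sup>+s. ennreal (indicator {0..T} s * k s) *
      ennreal (exp (- p * Y (max 0 (min T s)) \<omega>)) \<partial>lborel)"
      unfolding nn[OF c] by (intro nn_integral_cong) (auto split: split_indicator)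
  qed
  also have "\<dots> = (\<integral>\<^sup>+s. (\<integral>\<^sup>+\<omega>. ennreal (indicator {0..T} s * k s) *
      ennreal (exp (- p * Y (max 0 (min T s)) \<omega>)) \<partial>M) \<partial>lborel)"
    by (rule Fubini'[symmetric]) (simp add: split_beta')
  also have "\<dots> = (\<integral>\<^sup>+s. ennreal (indicator {0..T} s * k s) *
      (\<integral>\<^sup>+\<omega>. ennreal (exp (- p * Y (max 0 (min T s)) \<omega>)) \<partial>M) \<partial>lborel)"
    using T by (intro nn_integral_cong nn_integral_cmult measurable_compose[OF Y]) auto
  also have "\<dots> \<le> (\<integral>\<^sup>+s. ennreal (indicator {0..T} s * k s) * C \<partial>lborel)"
    using T by (intro nn_integral_mono mult_left_mono moment) auto
  also have "\<dots> = ennreal ?K * C"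
    by (simp add: nn_integral_multc nn)
  finally have "ennreal ?K * (\<integral>\<^sup>+\<omega>. ennreal ((?W \<omega> / ?K) powr (- p)) \<partial>M) \<le> ennreal ?K * C" .
  then show ?thesis
    using K by (subst (asm) ennreal_mult_le_mult_iff) auto
qed

section \<open>Densities from integral bounds\<close>

text \<open>Dominated by a measure with density \<open>\<beta>\<close>, the law is absolutely continuous, and its Radon-Nikodym
  derivative is at most \<open>\<beta>\<close> almost everywhere. Taking the minimum with \<open>\<beta>\<close> selects a version that obeys
  the bound everywhere.\<close>

lemma (in prob_space) density_exists_of_bound:
  fixes F \<beta> :: "_ \<Rightarrow> real"
  assumes F [measurable]: "F \<in> borel_measurable M" and \<beta> [measurable]: "\<beta> \<in> borel_measurable borel"
    and nonneg: "\<And>x. 0 \<le> \<beta> x"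
    and bound: "\<And>A. A \<in> sets borel \<Longrightarrow>
      emeasure M (F -` A \<inter> space M) \<le> (\<integral>\<^sup>+x. indicator A x * ennreal (\<beta> x) \<partial>lborel)"
  obtains \<rho> where "\<And>x. 0 \<le> \<rho> x" "\<And>x. \<rho> x \<le> \<beta> x" "distributed M lborel F (\<lambda>x. ennreal (\<rho> x))"
proof -
  let ?\<nu> = "distr M lborel F"
  have em: "emeasure ?\<nu> A \<le> (\<integral>\<^sup>+x. indicator A x * ennreal (\<beta> x) \<partial>lborel)" if "A \<in> sets borel" for A
    using bound[OF that] that by (simp add: emeasure_distr)
  have "absolutely_continuous lborel ?\<nu>"
    unfolding absolutely_continuous_def
  proof
    fix A assume A: "A \<in> null_sets (lborel :: real measure)"
    then have "AE x in lborel. x \<notin> A" by (rule AE_not_in)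
    then have "(\<integral>\<^sup>+x. indicator A x * ennreal (\<beta> x) \<partial>lborel) = (\<integral>\<^sup>+(x::real). 0 \<partial>lborel)"
      by (intro nn_integral_cong_AE) (auto simp: indicator_def)
    with em[of A] A show "A \<in> null_sets ?\<nu>" by (auto simp: null_sets_def)
  qed
  then have dens: "density lborel (RN_deriv lborel ?\<nu>) = ?\<nu>"
    by (rule sigma_finite_measure.density_RN_deriv[OF sigma_finite_lborel]) simp
  define r where "r = RN_deriv lborel ?\<nu>"
  have r [measurable]: "r \<in> borel_measurable borel"
    using borel_measurable_RN_deriv[of lborel ?\<nu>] by (simp add: r_def)
  define S where "S = {x. ennreal (\<beta> x) < r x}"
  have S [measurable]: "S \<in> sets borel" unfolding S_def by measurable
  have eS: "(\<integral>\<^sup>+x. indicator S x * r x \<partial>lborel) = emeasure ?\<nu> S"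
  proof -
    have "emeasure ?\<nu> S = emeasure (density lborel r) S"
      using dens by (simp add: r_def)
    also have "\<dots> = (\<integral>\<^sup>+x. indicator S x * r x \<partial>lborel)"
      by (subst emeasure_density) (auto intro!: nn_integral_cong simp: mult.commute)
    finally show ?thesis by simp
  qed
  interpret \<nu>: prob_space ?\<nu> by (rule prob_space_distr) simp
  have "AE x in lborel. indicator S x * r x \<le> indicator S x * ennreal (\<beta> x)"
  proof (rule ccontr)
    assume *: "\<not> ?thesis"
    have le: "AE x in lborel. indicator S x * ennreal (\<beta> x) \<le> indicator S x * r x"
      by (auto simp: S_def indicator_def)
    have "(\<integral>\<^sup>+x. indicator S x * ennreal (\<beta> x) \<partial>lborel) \<le> emeasure ?\<nu> S"
      unfolding eS[symmetric] using le by (rule nn_integral_mono_AE)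
    then have "(\<integral>\<^sup>+x. indicator S x * ennreal (\<beta> x) \<partial>lborel) \<noteq> \<infinity>"
      using \<nu>.emeasure_finite[of S] by (auto simp: top_unique)
    from nn_integral_less[OF _ _ this le *]
    have "(\<integral>\<^sup>+x. indicator S x * ennreal (\<beta> x) \<partial>lborel) < emeasure ?\<nu> S"
      by (simp add: eS)
    with em[OF S] show False by simp
  qed
  then have rle: "AE x in lborel. r x \<le> ennreal (\<beta> x)"
  proof eventually_elim
    case (elim x)
    then show ?case by (cases "x \<in> S") (auto simp: S_def)
  qed
  define \<rho> where "\<rho> x = enn2real (min (r x) (ennreal (\<beta> x)))" for x
  have \<rho>: "ennreal (\<rho> x) = min (r x) (ennreal (\<beta> x))" for x
    unfolding \<rho>_def by (rule ennreal_enn2real) (auto simp: min_less_iff_disj)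
  show thesis
  proof (rule that)
    show "0 \<le> \<rho> x" for x by (simp add: \<rho>_def)
    show "\<rho> x \<le> \<beta> x" for x
      using \<rho>[of x] nonneg[of x] by (metis ennreal_le_iff min.cobounded2)
    have "density lborel (\<lambda>x. ennreal (\<rho> x)) = density lborel r"
    proof (rule density_cong)
      show "AE x in lborel. ennreal (\<rho> x) = r x"
        using rle by eventually_elim (simp add: \<rho> min_absorb1)
    qed (simp_all add: \<rho>)
    then show "distributed M lborel F (\<lambda>x. ennreal (\<rho> x))"
      unfolding distributed_def using dens by (simp add: r_def[symmetric] \<rho>)
  qed
qed


text \<open>A Cauchy-Schwarz estimate in the parametric form \<open>G \<le> e G\<^sup>2 / 2 + 1 / (2 e)\<close>; the parameter can be
  chosen later to balance both terms.\<close>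

lemma nn_integral_on_event_le:
  fixes P :: "'a \<Rightarrow> bool"
  assumes [measurable]: "G \<in> borel_measurable M" "Measurable.pred M P" and e: "0 < e"
    and G: "\<And>\<omega>. \<omega> \<in> space M \<Longrightarrow> 0 \<le> G \<omega>"
  shows "(\<integral>\<^sup>+\<omega>. ennreal (G \<omega>) * indicator {\<omega>. P \<omega>} \<omega> \<partial>M)
    \<le> ennreal (e / 2) * (\<integral>\<^sup>+\<omega>. ennreal ((G \<omega>)\<^sup>2) \<partial>M) + ennreal (1 / (2 * e)) * emeasure M {\<omega> \<in> space M. P \<omega>}"
proof -
  have "(\<integral>\<^sup>+\<omega>. ennreal (G \<omega>) * indicator {\<omega>. P \<omega>} \<omega> \<partial>M)
    \<le> (\<integral>\<^sup>+\<omega>. ennreal (e / 2) * ennreal ((G \<omega>)\<^sup>2) + ennreal (1 / (2 * e)) * indicator {\<omega> \<in> space M. P \<omega>} \<omega> \<partial>M)"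
  proof (rule nn_integral_mono)
    fix \<omega> assume \<omega>: "\<omega> \<in> space M"
    have "0 \<le> (e * G \<omega> - 1)\<^sup>2 / (2 * e)" using e by simp
    also have "\<dots> = e / 2 * (G \<omega>)\<^sup>2 + 1 / (2 * e) - G \<omega>"
      using e by (simp add: power2_eq_square field_simps)
    finally have "G \<omega> \<le> e / 2 * (G \<omega>)\<^sup>2 + 1 / (2 * e)" by simp
    then have "ennreal (G \<omega>) \<le> ennreal (e / 2 * (G \<omega>)\<^sup>2 + 1 / (2 * e))" by (rule ennreal_leI)
    also have "\<dots> = ennreal (e / 2) * ennreal ((G \<omega>)\<^sup>2) + ennreal (1 / (2 * e))"
      using e ennreal_mult[of "e / 2" "(G \<omega>)\<^sup>2"] by (simp add: ennreal_plus)
    finally show "ennreal (G \<omega>) * indicator {\<omega>. P \<omega>} \<omega>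
      \<le> ennreal (e / 2) * ennreal ((G \<omega>)\<^sup>2) + ennreal (1 / (2 * e)) * indicator {\<omega> \<in> space M. P \<omega>} \<omega>"
      using \<omega> by (auto split: split_indicator)
  qed
  also have "\<dots> = ennreal (e / 2) * (\<integral>\<^sup>+\<omega>. ennreal ((G \<omega>)\<^sup>2) \<partial>M) + ennreal (1 / (2 * e)) * emeasure M {\<omega> \<in> space M. P \<omega>}"
    by (simp add: nn_integral_add nn_integral_cmult nn_integral_cmult_indicator)
  finally show ?thesis .
qed


section \<open>Exponential functionals of a Gaussian process\<close>

text \<open>The properties of fractional Brownian motion that enter: the final time has the largest variance,
  and every value is nonnegatively correlated with the final one.\<close>

locale gaussian_exponential_functional = centered_gaussian_process M "{0..T}" B
  for M :: "'a measure" and T :: real and B :: "real \<Rightarrow> 'a \<Rightarrow> real" +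
  fixes a \<sigma> :: real
  assumes T: "0 < T" and \<sigma>: "0 < \<sigma>"
    and paths: "\<And>\<omega>. \<omega> \<in> space M \<Longrightarrow> continuous_on {0..T} (\<lambda>t. B t \<omega>)"
    and var_pos: "0 < expectation (\<lambda>\<omega>. (B T \<omega>)\<^sup>2)"
    and var_le: "\<And>t. t \<in> {0..T} \<Longrightarrow> expectation (\<lambda>\<omega>. (B t \<omega>)\<^sup>2) \<le> expectation (\<lambda>\<omega>. (B T \<omega>)\<^sup>2)"
    and cov_nonneg: "\<And>t. t \<in> {0..T} \<Longrightarrow> 0 \<le> expectation (\<lambda>\<omega>. B t \<omega> * B T \<omega>)"
    and cov_cont: "continuous_on {0..T} (\<lambda>t. expectation (\<lambda>\<omega>. B t \<omega> * B T \<omega>))"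
begin

text \<open>\<open>\<xi>\<close> is the normalised final value, \<open>h\<close> the coefficient of its contribution to the process, and \<open>Z\<close> the
  remaining process, which is independent of \<open>\<xi>\<close>. The functional of interest is \<open>F\<close>, and \<open>D\<close> is its
  derivative with respect to \<open>\<xi>\<close> when \<open>Z\<close> is frozen.\<close>

definition v :: real where "v = expectation (\<lambda>\<omega>. (B T \<omega>)\<^sup>2)"
definition \<xi> :: "'a \<Rightarrow> real" where "\<xi> \<omega> = B T \<omega> / sqrt v"
definition h :: "real \<Rightarrow> real" where "h t = expectation (\<lambda>\<omega>. B t \<omega> * \<xi> \<omega>)"
definition Z :: "real \<Rightarrow> 'a \<Rightarrow> real" where "Z t \<omega> = B t \<omega> - h t * \<xi> \<omega>"
definition N :: "'a measure" where "N = process_algebra M {0..T} Z"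
definition Y :: "real \<Rightarrow> 'a \<Rightarrow> real" where "Y s \<omega> = a * s + \<sigma> * B s \<omega>"
definition F :: "'a \<Rightarrow> real" where "F \<omega> = exp_integral T (\<lambda>_. 1) (\<lambda>s. Y s \<omega>)"
definition D :: "'a \<Rightarrow> real" where "D \<omega> = exp_integral T (\<lambda>s. \<sigma> * h s) (\<lambda>s. Y s \<omega>)"
definition exp_moment_bound :: "real \<Rightarrow> real" where "exp_moment_bound p = exp (p * \<bar>a\<bar> * T + p\<^sup>2 * \<sigma>\<^sup>2 * v / 2)"

lemma v: "0 < v"
  using var_pos by (simp add: v_def)

lemma T0: "0 \<le> T" and TI: "T \<in> {0..T}"
  using T by simp_all

lemma h_cov: "h t = expectation (\<lambda>\<omega>. B t \<omega> * B T \<omega>) / sqrt v"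
  by (simp add: h_def \<xi>_def)

lemma \<sigma>h_cont: "continuous_on {0..T} (\<lambda>s. \<sigma> * h s)"
  unfolding h_cov using v by (intro continuous_intros cov_cont) auto

lemma \<sigma>h_nonneg: "s \<in> {0..T} \<Longrightarrow> 0 \<le> \<sigma> * h s"
  using cov_nonneg[of s] \<sigma> v by (simp add: h_cov)

lemma \<sigma>h_T: "0 < \<sigma> * h T"
  using \<sigma> v by (simp add: h_cov v_def power2_eq_square)

lemma B_meas: "t \<in> {0..T} \<Longrightarrow> B t \<in> borel_measurable M"
  by (rule measurable_lin_comb[OF lin_comb_single])

lemma \<xi>_meas [measurable]: "\<xi> \<in> borel_measurable M"
  unfolding \<xi>_def using B_meas[OF TI] by simp

lemma gaussian_splitting:
  shows \<xi>_law: "distr M borel \<xi> = std_normal_distribution"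
    and N: "sets N \<subseteq> sets M" "space N = space M"
    and \<xi>_N_law: "distr M (borel \<Otimes>\<^sub>M N) (\<lambda>\<omega>. (\<xi> \<omega>, \<omega>)) = std_normal_distribution \<Otimes>\<^sub>M distr M N (\<lambda>\<omega>. \<omega>)"
proof -
  have \<xi>: "B T \<omega> / sqrt (expectation (\<lambda>\<omega>. (B T \<omega>)\<^sup>2)) = \<xi> \<omega>" for \<omega>
    by (simp add: \<xi>_def v_def)
  have N': "N = process_algebra M {0..T} (\<lambda>t \<omega>. B t \<omega> - expectation (\<lambda>\<omega>. B t \<omega> * \<xi> \<omega>) * \<xi> \<omega>)"
    by (simp add: N_def Z_def[abs_def] h_def)
  note * = split_off_coordinate[OF TI var_pos, unfolded \<xi>, folded N']
  show "distr M borel \<xi> = std_normal_distribution" by (rule *(1))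
  show "sets N \<subseteq> sets M" by (rule *(2))
  show "space N = space M" by (simp add: N_def)
  show "distr M (borel \<Otimes>\<^sub>M N) (\<lambda>\<omega>. (\<xi> \<omega>, \<omega>)) = std_normal_distribution \<Otimes>\<^sub>M distr M N (\<lambda>\<omega>. \<omega>)"
    by (rule *(3))
qed

lemma Y_meas: "s \<in> {0..T} \<Longrightarrow> Y s \<in> borel_measurable M"
  unfolding Y_def using B_meas[of s] by measurable

lemma Y_paths: "\<omega> \<in> space M \<Longrightarrow> continuous_on {0..T} (\<lambda>s. Y s \<omega>)"
  unfolding Y_def by (intro continuous_intros paths)

lemma F_meas [measurable]: "F \<in> borel_measurable M"
  unfolding F_def by (rule exp_integral_measurable[OF T0 _ Y_meas Y_paths]) auto

lemma D_meas [measurable]: "D \<in> borel_measurable M"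
  unfolding D_def by (rule exp_integral_measurable[OF T0 \<sigma>h_cont Y_meas Y_paths])

lemma F_pos: "\<omega> \<in> space M \<Longrightarrow> 0 < F \<omega>"
  unfolding F_def by (rule exp_integral_pos[OF T _ Y_paths _ TI]) auto

lemma D_pos: "\<omega> \<in> space M \<Longrightarrow> 0 < D \<omega>"
  unfolding D_def by (rule exp_integral_pos[OF T \<sigma>h_cont Y_paths \<sigma>h_nonneg TI \<sigma>h_T])

text \<open>For a frozen path of \<open>Z\<close>, both \<open>F\<close> and \<open>D\<close> are functions \<open>f\<close> and \<open>f'\<close> of the value of \<open>\<xi>\<close>; the
  derivative \<open>f'\<close> increases because \<open>h\<close> is nonnegative.\<close>

lemma law_bound:
  assumes A: "A \<in> sets borel"
  shows "emeasure M (F -` A \<inter> space M) \<le> (\<integral>\<^sup>+x. indicator A x *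
    (\<integral>\<^sup>+\<omega>. ennreal (\<bar>\<xi> \<omega>\<bar> / D \<omega>) * indicator {\<omega>. F \<omega> \<le> x} \<omega> \<partial>M) \<partial>lborel)"
proof -
  let ?I = "{0..T}"
  have Z_meas: "Z t \<in> borel_measurable N" if "t \<in> ?I" for t
    unfolding N_def by (rule measurable_process_algebra[OF that])
  have h_cont: "continuous_on ?I h"
    unfolding h_cov using v by (intro continuous_intros cov_cont) auto
  have Z_paths: "continuous_on ?I (\<lambda>t. Z t \<omega>)" if "\<omega> \<in> space M" for \<omega>
    unfolding Z_def by (intro continuous_intros paths[OF that] h_cont)
  define g where "g s z = a * s + \<sigma> * Z s (snd z) + fst z * (\<sigma> * h s)" for s and z :: "real \<times> 'a"
  define f where "f z = exp_integral T (\<lambda>_. 1) (\<lambda>s. g s z)" for z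
  define f' where "f' z = exp_integral T (\<lambda>s. \<sigma> * h s) (\<lambda>s. g s z)" for z
  have g_meas: "g s \<in> borel_measurable (borel \<Otimes>\<^sub>M N)" if "s \<in> ?I" for s
    unfolding g_def using Z_meas[OF that] by measurable
  have g_paths: "continuous_on ?I (\<lambda>s. g s z)" if "z \<in> space (borel \<Otimes>\<^sub>M N)" for z
    unfolding g_def using that N
    by (intro continuous_intros Z_paths h_cont) (auto simp: space_pair_measure)
  have g0_paths: "continuous_on ?I (\<lambda>s. a * s + \<sigma> * Z s \<omega>)" if "\<omega> \<in> space M" for \<omega>
    by (intro continuous_intros Z_paths that)
  have f_meas: "f \<in> borel_measurable (borel \<Otimes>\<^sub>M N)"
    unfolding f_def by (rule exp_integral_measurable[OF T0 _ g_meas g_paths]) auto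
  have f'_meas: "f' \<in> borel_measurable (borel \<Otimes>\<^sub>M N)"
    unfolding f'_def by (rule exp_integral_measurable[OF T0 \<sigma>h_cont g_meas g_paths]) auto
  have f_deriv: "((\<lambda>x. f (x, \<omega>)) has_real_derivative f' (x, \<omega>)) (at x)" if "\<omega> \<in> space M" for x \<omega>
    using exp_integral_shift_derivative(1)[OF _ g0_paths[OF that] \<sigma>h_cont, of "\<lambda>_. 1" x]
    by (simp add: f_def f'_def g_def)
  have f'_cont: "continuous_on UNIV (\<lambda>x. f' (x, \<omega>))" if "\<omega> \<in> space M" for \<omega>
    using exp_integral_shift_derivative(2)[OF \<sigma>h_cont g0_paths[OF that] \<sigma>h_cont]
    by (simp add: f'_def g_def)
  have gx_paths: "continuous_on ?I (\<lambda>s. g s (x, \<omega>))" if "\<omega> \<in> space M" for x \<omega>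
    using that by (intro g_paths) (auto simp: space_pair_measure N)
  have f'_pos: "0 < f' (x, \<omega>)" if "\<omega> \<in> space M" for x \<omega>
    unfolding f'_def by (rule exp_integral_pos[OF T \<sigma>h_cont gx_paths[OF that] \<sigma>h_nonneg TI \<sigma>h_T])
  have f'_mono: "mono (\<lambda>x. f' (x, \<omega>))" if "\<omega> \<in> space M" for \<omega>
  proof (rule monoI, unfold f'_def, rule exp_integral_mono[OF \<sigma>h_cont gx_paths[OF that] gx_paths[OF that] \<sigma>h_nonneg])
    fix x y s :: real assume "x \<le> y" "s \<in> ?I"
    then have "g s (x, \<omega>) \<le> g s (y, \<omega>)"
      unfolding g_def by (simp add: mult_right_mono \<sigma>h_nonneg)
    then show "\<sigma> * h s * exp (g s (x, \<omega>)) \<le> \<sigma> * h s * exp (g s (y, \<omega>))"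
      using \<sigma>h_nonneg[OF \<open>s \<in> ?I\<close>] by (intro mult_left_mono) auto
  qed auto
  have g_Y: "g s (\<xi> \<omega>, \<omega>) = Y s \<omega>" for s \<omega>
    by (simp add: g_def Y_def Z_def algebra_simps)
  have F_f: "F \<omega> = f (\<xi> \<omega>, \<omega>)" for \<omega>
    by (simp add: F_def f_def g_Y)
  have D_f': "D \<omega> = f' (\<xi> \<omega>, \<omega>)" for \<omega>
    by (simp add: D_def f'_def g_Y)
  have ind: "indicator {F \<omega>..} x = (indicator {\<omega>. F \<omega> \<le> x} \<omega> :: ennreal)" for \<omega> x
    by (simp split: split_indicator)
  have set: "F -` A \<inter> space M = {\<omega> \<in> space M. F \<omega> \<in> A}" by auto
  show ?thesis
    using law_bound_by_gaussian_coordinate[OF N \<xi>_meas \<xi>_N_law f_meas f'_meas f_deriv f'_cont f'_pos f'_mono A]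
    unfolding set by (simp only: F_f[symmetric] D_f'[symmetric] ind)
qed

text \<open>The exponential moment of \<open>B s\<close> is explicit, and the variance of \<open>B s\<close> is at most \<open>v\<close>.\<close>

lemma negative_exp_moment:
  assumes s: "s \<in> {0..T}" and p: "0 \<le> p"
  shows "(\<integral>\<^sup>+\<omega>. ennreal (exp (- p * Y s \<omega>)) \<partial>M) \<le> ennreal (exp_moment_bound p)"
proof -
  have Bs: "lin_comb {0..T} B (B s)" by (rule lin_comb_single[OF s])
  have [measurable]: "B s \<in> borel_measurable M" by (rule B_meas[OF s])
  have "(\<integral>\<^sup>+\<omega>. ennreal (exp (- p * Y s \<omega>)) \<partial>M)
    = (\<integral>\<^sup>+\<omega>. ennreal (exp (- p * a * s)) * ennreal (exp ((- p * \<sigma>) * B s \<omega>)) \<partial>M)"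
    by (intro nn_integral_cong) (simp add: Y_def algebra_simps flip: exp_add ennreal_mult)
  also have "\<dots> = ennreal (exp (- p * a * s)) * (\<integral>\<^sup>+\<omega>. ennreal (exp ((- p * \<sigma>) * B s \<omega>)) \<partial>M)"
    by (rule nn_integral_cmult) simp
  also have "\<dots> = ennreal (exp (- p * a * s + (- p * \<sigma>)\<^sup>2 * expectation (\<lambda>\<omega>. (B s \<omega>)\<^sup>2) / 2))"
    by (simp only: exp_moment_lin_comb[OF Bs]
        exp_add ennreal_mult exp_ge_zero)
  also have "\<dots> \<le> ennreal (exp_moment_bound p)"
  proof (intro ennreal_leI, unfold exp_moment_bound_def, subst exp_le_cancel_iff, rule add_mono)
    have "- (p * (a * s)) \<le> p * (\<bar>a\<bar> * T)"
    proof -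
      have "- (a * s) \<le> \<bar>a\<bar> * s" using s by (metis abs_ge_minus_self abs_mult abs_of_nonneg atLeastAtMost_iff)
      also have "\<dots> \<le> \<bar>a\<bar> * T" using s by (intro mult_left_mono) auto
      finally show ?thesis using mult_left_mono[OF _ p, of "- (a * s)" "\<bar>a\<bar> * T"] by simp
    qed
    then show "- p * a * s \<le> p * \<bar>a\<bar> * T" by (simp add: mult.assoc)
    have "expectation (\<lambda>\<omega>. (B s \<omega>)\<^sup>2) \<le> v"
      unfolding v_def by (rule var_le[OF s])
    then have "(p * \<sigma>)\<^sup>2 * expectation (\<lambda>\<omega>. (B s \<omega>)\<^sup>2) \<le> (p * \<sigma>)\<^sup>2 * v"
      by (intro mult_left_mono) auto
    then show "(- p * \<sigma>)\<^sup>2 * expectation (\<lambda>\<omega>. (B s \<omega>)\<^sup>2) / 2 \<le> p\<^sup>2 * \<sigma>\<^sup>2 * v / 2"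
      by (simp add: power_mult_distrib)
  qed
  finally show ?thesis .
qed

text \<open>Markov's inequality for \<open>(F / T)\<^bsup>-p\<^esup>\<close>.\<close>

lemma lower_tail:
  assumes x: "0 < x" and p: "0 \<le> p"
  shows "emeasure M {\<omega> \<in> space M. F \<omega> \<le> x} \<le> ennreal ((x / T) powr p * exp_moment_bound p)"
proof -
  have K: "exp_integral T (\<lambda>_. 1) (\<lambda>_. 0) = T"
    using T by (subst exp_integral_eq_integral) auto
  have "emeasure M {\<omega> \<in> space M. F \<omega> \<le> x} = (\<integral>\<^sup>+\<omega>. indicator {\<omega> \<in> space M. F \<omega> \<le> x} \<omega> \<partial>M)"
    by simp
  also have "\<dots> \<le> (\<integral>\<^sup>+\<omega>. ennreal ((x / T) powr p) * ennreal ((F \<omega> / T) powr (- p)) \<partial>M)"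
  proof (rule nn_integral_mono)
    fix \<omega> assume \<omega>: "\<omega> \<in> space M"
    have "1 \<le> (x / T) powr p * (F \<omega> / T) powr (- p)" if "F \<omega> \<le> x"
    proof -
      have "(F \<omega> / T) powr p \<le> (x / T) powr p"
        using F_pos[OF \<omega>] T that p by (intro powr_mono2) (auto simp: divide_right_mono)
      moreover have "0 < (F \<omega> / T) powr p" using F_pos[OF \<omega>] T by simp
      ultimately show ?thesis by (simp add: powr_minus_divide)
    qed
    then show "indicator {\<omega> \<in> space M. F \<omega> \<le> x} \<omega>
      \<le> ennreal ((x / T) powr p) * ennreal ((F \<omega> / T) powr (- p))"
      by (auto simp: ennreal_mult[symmetric] split: split_indicator)
  qed
  also have "\<dots> = ennreal ((x / T) powr p) * (\<integral>\<^sup>+\<omega>. ennreal ((F \<omega> / T) powr (- p)) \<partial>M)"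
    by (rule nn_integral_cmult) measurable
  also have "\<dots> \<le> ennreal ((x / T) powr p) * ennreal (exp_moment_bound p)"
    using exp_integral_negative_moment[OF prob_space_axioms T _ _ TI _ p Y_meas Y_paths negative_exp_moment[OF _ p], of "\<lambda>_. 1"]
    by (intro mult_left_mono) (simp_all add: K F_def)
  finally show ?thesis by (simp add: ennreal_mult exp_moment_bound_def)
qed

text \<open>By the arithmetic-geometric mean inequality it suffices to bound the fourth moments of \<open>\<xi>\<close> and of
  \<open>1 / D\<close>; the latter is a negative moment of an exponential integral with weight \<open>\<sigma> h\<close>, which does not
  vanish identically since \<open>h T > 0\<close>.\<close>

lemma weight_square_integrable:
  "(\<integral>\<^sup>+\<omega>. ennreal ((\<bar>\<xi> \<omega>\<bar> / D \<omega>)\<^sup>2) \<partial>M) < \<infinity>"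
proof -
  define K where "K = exp_integral T (\<lambda>s. \<sigma> * h s) (\<lambda>_. 0)"
  have K: "0 < K"
    unfolding K_def by (rule exp_integral_pos[OF T \<sigma>h_cont _ \<sigma>h_nonneg TI \<sigma>h_T]) auto
  have "(\<integral>\<^sup>+\<omega>. ennreal ((\<bar>\<xi> \<omega>\<bar> / D \<omega>)\<^sup>2) \<partial>M)
    \<le> (\<integral>\<^sup>+\<omega>. ennreal (\<xi> \<omega> ^ 4) + ennreal (K powr (- 4)) * ennreal ((D \<omega> / K) powr (- 4)) \<partial>M)"
  proof (rule nn_integral_mono)
    fix \<omega> assume \<omega>: "\<omega> \<in> space M"
    have D4: "K powr (- 4) * (D \<omega> / K) powr (- 4) = (1 / D \<omega>) ^ 4"
      using K D_pos[OF \<omega>] powr_realpow[of "D \<omega>" 4]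
      by (simp add: powr_minus_divide powr_divide power_divide)
    have "(\<bar>\<xi> \<omega>\<bar> / D \<omega>)\<^sup>2 = (\<xi> \<omega>)\<^sup>2 * (1 / D \<omega>)\<^sup>2"
      by (simp add: power_divide)
    also have "\<dots> \<le> 2 * ((\<xi> \<omega>)\<^sup>2 * (1 / D \<omega>)\<^sup>2)" by simp
    also have "\<dots> \<le> ((\<xi> \<omega>)\<^sup>2)\<^sup>2 + ((1 / D \<omega>)\<^sup>2)\<^sup>2"
      using sum_squares_bound[of "(\<xi> \<omega>)\<^sup>2" "(1 / D \<omega>)\<^sup>2"] by (simp add: mult.assoc)
    also have "\<dots> = \<xi> \<omega> ^ 4 + K powr (- 4) * (D \<omega> / K) powr (- 4)"
      unfolding D4 by (simp flip: power_mult)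
    finally have "(\<bar>\<xi> \<omega>\<bar> / D \<omega>)\<^sup>2 \<le> \<xi> \<omega> ^ 4 + K powr (- 4) * (D \<omega> / K) powr (- 4)" .
    from ennreal_leI[OF this] show "ennreal ((\<bar>\<xi> \<omega>\<bar> / D \<omega>)\<^sup>2)
      \<le> ennreal (\<xi> \<omega> ^ 4) + ennreal (K powr (- 4)) * ennreal ((D \<omega> / K) powr (- 4))"
      by (simp add: ennreal_plus ennreal_mult)
  qed
  also have "\<dots> = (\<integral>\<^sup>+\<omega>. ennreal (\<xi> \<omega> ^ 4) \<partial>M)
      + ennreal (K powr (- 4)) * (\<integral>\<^sup>+\<omega>. ennreal ((D \<omega> / K) powr (- 4)) \<partial>M)"
    by (subst nn_integral_add) (auto simp: nn_integral_cmult)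
  also have "\<dots> \<le> (\<integral>\<^sup>+\<omega>. ennreal (\<xi> \<omega> ^ 4) \<partial>M) + ennreal (K powr (- 4)) * ennreal (exp_moment_bound 4)"
    using exp_integral_negative_moment[OF prob_space_axioms T \<sigma>h_cont \<sigma>h_nonneg TI \<sigma>h_T _ Y_meas Y_paths negative_exp_moment, of 4]
    by (intro add_mono mult_left_mono) (simp_all add: D_def K_def)
  also have "\<dots> < \<infinity>"
  proof -
    have "(\<integral>\<^sup>+\<omega>. ennreal (\<xi> \<omega> ^ 4) \<partial>M) = (\<integral>\<^sup>+x. ennreal (x ^ 4) \<partial>distr M borel \<xi>)"
      by (simp add: nn_integral_distr)
    also have "\<dots> = (\<integral>\<^sup>+x. ennreal (x ^ 4) \<partial>std_normal_distribution)"
      by (simp add: \<xi>_law)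
    also have "\<dots> = ennreal (\<integral>x. x ^ 4 \<partial>std_normal_distribution)"
      by (rule nn_integral_eq_integral[OF integrable_std_normal_distribution_moment]) auto
    finally show ?thesis by (simp add: ennreal_mult_less_top)
  qed
  finally show ?thesis .
qed

text \<open>The centre \<open>m\<close> is arbitrary: replacing the natural centre \<open>k\<close> of the tail estimate by \<open>m\<close> only
  costs a factor of \<open>2\<close> in the exponent and a constant.\<close>

theorem density_bound:
  fixes m :: real
  obtains \<rho> :: "real \<Rightarrow> real" and c :: real where "\<And>x. 0 \<le> \<rho> x" "distributed M lborel F (\<lambda>x. ennreal (\<rho> x))" "0 < c"
    "\<And>x. 0 < x \<Longrightarrow> x \<le> exp m \<Longrightarrow> \<rho> x \<le> c / x * exp (- ((ln x - m)\<^sup>2 / (8 * \<sigma>\<^sup>2 * v)))"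
proof -
  define k where "k = ln T - \<bar>a\<bar> * T"
  define L where "L = \<sigma>\<^sup>2 * v"
  have L: "0 < L" using \<sigma> v by (simp add: L_def)
  \<comment> \<open>\<open>q x\<close> is the square root of the tail estimate and will serve as the balancing parameter.\<close>
  define q where "q x = exp (- (ln x - k)\<^sup>2 / (4 * L))" for x :: real
  define E where "E = exp ((m - k)\<^sup>2 / (2 * L))"
  have E: "1 \<le> E" using L by (simp add: E_def)
  have gauss_tail: "emeasure M {\<omega> \<in> space M. F \<omega> \<le> x} \<le> ennreal (E * (q x)\<^sup>2)"
    if x: "0 < x" and xm: "x \<le> exp m" for x
  proof (cases "ln x \<le> k")
    case True
    \<comment> \<open>The minimiser of the exponent \<open>p (ln x - k) + p\<^sup>2 L / 2\<close>.\<close>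
    define p where "p = (k - ln x) / L"
    have p: "0 \<le> p" using True L by (simp add: p_def)
    have pL: "p * L = k - ln x" using L by (simp add: p_def)
    have "(x / T) powr p * exp_moment_bound p = exp (p * (ln x - ln T) + (p * \<bar>a\<bar> * T + p\<^sup>2 * \<sigma>\<^sup>2 * v / 2))"
      using x T by (simp add: powr_def exp_moment_bound_def ln_div exp_add)
    also have "p * (ln x - ln T) + (p * \<bar>a\<bar> * T + p\<^sup>2 * \<sigma>\<^sup>2 * v / 2) = p * (ln x - k) + p * (p * L) / 2"
      by (simp add: k_def L_def power2_eq_square algebra_simps)
    also have "\<dots> = - (ln x - k)\<^sup>2 / (2 * L)"
      unfolding pL using L by (simp add: p_def power2_eq_square field_simps)
    also have "exp \<dots> = (q x)\<^sup>2"
      by (simp add: q_def flip: exp_double)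
    finally have "(x / T) powr p * exp_moment_bound p = (q x)\<^sup>2" .
    with lower_tail[OF x p] have "emeasure M {\<omega> \<in> space M. F \<omega> \<le> x} \<le> ennreal ((q x)\<^sup>2)" by simp
    also have "\<dots> \<le> ennreal (E * (q x)\<^sup>2)"
      using E by (intro ennreal_leI) (simp add: mult_le_cancel_right1)
    finally show ?thesis .
  next
    case False
    \<comment> \<open>Between \<open>k\<close> and \<open>m\<close> the constant \<open>E\<close> makes the estimate trivial.\<close>
    have "ln x \<le> m" using ln_mono[OF xm x] by simp
    then have "(ln x - k)\<^sup>2 \<le> (m - k)\<^sup>2" using False by (intro power_mono) auto
    then have "0 \<le> (m - k)\<^sup>2 / (2 * L) + 2 * (- (ln x - k)\<^sup>2 / (4 * L))"
      using L by (simp add: field_simps)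
    then have "1 \<le> exp ((m - k)\<^sup>2 / (2 * L) + 2 * (- (ln x - k)\<^sup>2 / (4 * L)))" by simp
    also have "\<dots> = E * (q x)\<^sup>2"
      unfolding E_def q_def by (simp only: exp_add exp_double)
    finally have "ennreal 1 \<le> ennreal (E * (q x)\<^sup>2)" by (rule ennreal_leI)
    moreover have "emeasure M {\<omega> \<in> space M. F \<omega> \<le> x} \<le> 1" by (rule emeasure_le_1)
    ultimately show ?thesis by (simp add: order_trans)
  qed

  obtain G where G: "0 \<le> G" "(\<integral>\<^sup>+\<omega>. ennreal ((\<bar>\<xi> \<omega>\<bar> / D \<omega>)\<^sup>2) \<partial>M) = ennreal G"
    using weight_square_integrable
    by (cases "\<integral>\<^sup>+\<omega>. ennreal ((\<bar>\<xi> \<omega>\<bar> / D \<omega>)\<^sup>2) \<partial>M") auto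
  define b where "b x = (\<integral>\<^sup>+\<omega>. ennreal (\<bar>\<xi> \<omega>\<bar> / D \<omega>) * indicator {\<omega>. F \<omega> \<le> x} \<omega> \<partial>M)" for x
  have b_le: "b x \<le> ennreal (e / 2 * G + 1 / (2 * e) * P)"
    if e: "0 < e" and P: "0 \<le> P" "emeasure M {\<omega> \<in> space M. F \<omega> \<le> x} \<le> ennreal P" for x e P
  proof -
    have "b x \<le> ennreal (e / 2) * ennreal G + ennreal (1 / (2 * e)) * emeasure M {\<omega> \<in> space M. F \<omega> \<le> x}"
      unfolding b_def G(2)[symmetric]
      by (rule nn_integral_on_event_le[OF _ _ e]) (use D_pos in \<open>auto simp: less_imp_le\<close>)
    also have "\<dots> \<le> ennreal (e / 2) * ennreal G + ennreal (1 / (2 * e)) * ennreal P"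
      by (intro add_left_mono mult_left_mono P) simp
    also have "\<dots> = ennreal (e / 2 * G + 1 / (2 * e) * P)"
      using e G(1) P(1) ennreal_mult[of "e / 2" G] ennreal_mult[of "1 / (2 * e)" P]
      by (simp add: ennreal_plus)
    finally show ?thesis .
  qed
  define A where "A = (G + E) / 2"
  have A: "0 < A" using G E by (simp add: A_def)
  \<comment> \<open>Outside the range of interest a constant suffices; \<open>A\<close> dominates the estimate with parameter \<open>1\<close>.\<close>
  define \<beta> where "\<beta> x = (if 0 < x \<and> x \<le> exp m then A * q x else A)" for x
  have \<beta>_nonneg: "0 \<le> \<beta> x" for x using A by (simp add: \<beta>_def q_def)
  have [measurable]: "\<beta> \<in> borel_measurable borel"
    unfolding \<beta>_def q_def by measurable
  have b_\<beta>: "b x \<le> ennreal (\<beta> x)" for x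
  proof (cases "0 < x \<and> x \<le> exp m")
    case True
    have q: "0 < q x" by (simp add: q_def)
    have "b x \<le> ennreal (q x / 2 * G + 1 / (2 * q x) * (E * (q x)\<^sup>2))"
      using True E by (intro b_le q gauss_tail) auto
    also have "q x / 2 * G + 1 / (2 * q x) * (E * (q x)\<^sup>2) = A * q x"
      using q by (simp add: A_def power2_eq_square field_simps)
    finally show ?thesis using True by (simp add: \<beta>_def)
  next
    case False
    have "b x \<le> ennreal (1 / 2 * G + 1 / (2 * 1) * 1)"
      by (rule b_le) (simp_all add: emeasure_le_1)
    also have "\<dots> \<le> ennreal (\<beta> x)"
      using False E by (intro ennreal_leI) (auto simp: \<beta>_def A_def)
    finally show ?thesis .
  qed
  obtain \<rho> where \<rho>: "\<And>x. 0 \<le> \<rho> x" "\<And>x. \<rho> x \<le> \<beta> x" "distributed M lborel F (\<lambda>x. ennreal (\<rho> x))"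
  proof (rule density_exists_of_bound[OF F_meas _ \<beta>_nonneg])
    fix A :: "real set" assume "A \<in> sets borel"
    then show "emeasure M (F -` A \<inter> space M) \<le> (\<integral>\<^sup>+x. indicator A x * ennreal (\<beta> x) \<partial>lborel)"
      by (intro order_trans[OF law_bound[folded b_def]] nn_integral_mono mult_left_mono b_\<beta>) auto
  qed auto

  define c where "c = A * exp (m + (k - m)\<^sup>2 / (4 * L))"
  have bound: "\<rho> x \<le> c / x * exp (- ((ln x - m)\<^sup>2 / (8 * \<sigma>\<^sup>2 * v)))" if x: "0 < x" "x \<le> exp m" for x
  proof -
    \<comment> \<open>This is where half of the exponent is spent on moving the centre from \<open>k\<close> to \<open>m\<close>.\<close>
    have "(ln x - m)\<^sup>2 \<le> 2 * (ln x - k)\<^sup>2 + 2 * (k - m)\<^sup>2"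
    proof -
      have "0 \<le> ((ln x - k) - (k - m))\<^sup>2" by simp
      then show ?thesis by (simp add: power2_eq_square algebra_simps)
    qed
    then have "(ln x - m)\<^sup>2 / (8 * L) \<le> (2 * (ln x - k)\<^sup>2 + 2 * (k - m)\<^sup>2) / (8 * L)"
      using L by (intro divide_right_mono) auto
    also have "\<dots> = (ln x - k)\<^sup>2 / (4 * L) + (k - m)\<^sup>2 / (4 * L)"
      using L by (simp add: field_simps)
    finally have 1: "- (ln x - k)\<^sup>2 / (4 * L) \<le> (k - m)\<^sup>2 / (4 * L) + - ((ln x - m)\<^sup>2 / (8 * L))"
      by simp
    have 2: "ln x \<le> m" using ln_mono[OF x(2) x(1)] by simp
    have "\<rho> x \<le> A * q x" using \<rho>(2)[of x] x by (simp add: \<beta>_def)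
    also have "\<dots> \<le> A * exp ((m - ln x) + ((k - m)\<^sup>2 / (4 * L) + - ((ln x - m)\<^sup>2 / (8 * L))))"
      using A 1 2 unfolding q_def by (intro mult_left_mono) auto
    also have "\<dots> = c / x * exp (- ((ln x - m)\<^sup>2 / (8 * L)))"
    proof -
      have "exp (m - ln x) = exp m / x" using x by (simp add: exp_diff)
      then show ?thesis unfolding exp_add c_def by (simp only: times_divide_eq_left times_divide_eq_right mult.assoc)
    qed
    finally show ?thesis by (simp add: L_def mult.assoc)
  qed
  have "0 < c" using A by (simp add: c_def)
  with \<rho>(1,3) show thesis using bound by (rule that)
qed

end


section \<open>Exponential functionals of fractional Brownian motion\<close>

theorem theorem3p1:
  fixes M :: "'a measure" and B :: "real \<Rightarrow> 'a \<Rightarrow> real" and F :: "'a \<Rightarrow> real"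
    and T a \<sigma> H :: real
  assumes "T > 0" and "\<sigma> > 0" and "1 / 2 < H" and "H < 1"
    and "fractional_brownian_motion M T H B"
    and "F = (\<lambda>\<omega>. LBINT s:{0..T}. exp (a * s + \<sigma> * B s \<omega>))"
  shows "\<exists>\<rho> :: real \<Rightarrow> real. (\<forall>x. 0 \<le> \<rho> x) \<and>
           distributed M lborel F (\<lambda>x. ennreal (\<rho> x)) \<and>
           (\<exists>c > 0. \<forall>x. 0 < x \<and> x \<le> exp (\<integral>\<omega>. ln (F \<omega>) \<partial>M) \<longrightarrow>
              \<rho> x \<le> c / x * exp (- ((ln x - (\<integral>\<omega>. ln (F \<omega>) \<partial>M))\<^sup>2 /
                                   (8 * \<sigma>\<^sup>2 * T powr (2 * H)))))"
proof -
  note T = assms(1) and H = assms(3) and fbm = assms(5)[unfolded fractional_brownian_motion_def]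
  interpret prob_space M using fbm by (simp add: gaussian_process_def)
  have cov: "expectation (\<lambda>\<omega>. B t \<omega> * B s \<omega>)
    = 1 / 2 * (t powr (2 * H) + s powr (2 * H) - \<bar>t - s\<bar> powr (2 * H))"
    if "s \<in> {0..T}" "t \<in> {0..T}" for s t
    using fbm that by blast
  have var: "expectation (\<lambda>\<omega>. (B t \<omega>)\<^sup>2) = t powr (2 * H)" if "t \<in> {0..T}" for t
    using cov[OF that that] by (simp add: power2_eq_square)
  have cov_T: "expectation (\<lambda>\<omega>. B t \<omega> * B T \<omega>) = 1 / 2 * (t powr (2 * H) + T powr (2 * H) - (T - t) powr (2 * H))"
    if "t \<in> {0..T}" for t
    using that by (subst cov) auto
  interpret gaussian_exponential_functional M T B a \<sigma>
  proof unfold_locales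
    show "gaussian_process M {0..T} B" using fbm by blast
    show "expectation (B t) = 0" if "t \<in> {0..T}" for t using fbm that by auto
    show "continuous_on {0..T} (\<lambda>t. B t \<omega>)" if "\<omega> \<in> space M" for \<omega> using fbm that by blast
    show "0 < expectation (\<lambda>\<omega>. (B T \<omega>)\<^sup>2)" using T by (subst var) auto
    show "expectation (\<lambda>\<omega>. (B t \<omega>)\<^sup>2) \<le> expectation (\<lambda>\<omega>. (B T \<omega>)\<^sup>2)" if "t \<in> {0..T}" for t
      using that T H by (simp add: var powr_mono2)
    show "0 \<le> expectation (\<lambda>\<omega>. B t \<omega> * B T \<omega>)" if "t \<in> {0..T}" for t
      using powr_mono2[of "2 * H" "T - t" T] that H by (simp add: cov_T add_increasing)
    have "continuous_on {0..T} (\<lambda>t. 1 / 2 * (t powr (2 * H) + T powr (2 * H) - (T - t) powr (2 * H)))"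
      using T H by (intro continuous_intros continuous_on_powr') auto
    then show "continuous_on {0..T} (\<lambda>t. expectation (\<lambda>\<omega>. B t \<omega> * B T \<omega>))"
      by (simp add: cov_T cong: continuous_on_cong_simp)
  qed (use assms in auto)
  have F_eq: "F = gaussian_exponential_functional.F T B a \<sigma>"
    by (intro ext) (simp add: assms(6) F_def exp_integral_def Y_def)
  have v_eq: "v = T powr (2 * H)"
    using T by (simp add: v_def var)
  show ?thesis
    using density_bound[of "\<integral>\<omega>. ln (F \<omega>) \<partial>M"] unfolding F_eq v_eq by metis
qed

end
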